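(* Let $d_1,\dots,d_m>0$ and $d:=(d_1,\dots,d_m)$. Let $f:Q_{d,2}\to\mathbb{R}$ and let $u:\mathbb{R}^n\to\mathbb{R}$ be a solution of $Lu=f$ in $Q_{d,2}$. Then, for any $t\in(-d_m,d_m)$ with $t\neq 0$, $$\frac{|u(te_n)-u(-te_n)|}{|t|}\le \frac{d_m\,\mathfrak{S}}{a}+\frac{\tilde C\,d_m\,\|u\|_{L^\infty(\mathbb{R}^n)}}{\displaystyle\min_{i\in\{1,\dots,m\}}\big(\eta_i d_i^{2s_i}\big)},$$ where $$\mathfrak{S}:=\sup_{(x,\tau)\in Q_d\times(0,d_m)}|f(x+\tau e_n)-f(x-\tau e_n)|\qquad\text{and}\qquad \tilde C:=\frac{2(a_1+\dots+a_m)}{a}+1.$$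
   Context: Setting. $\{e_1,\dots,e_n\}$ is the Euclidean basis of $\mathbb{R}^n$. Let $m\in\mathbb{N}$ and $N_1,\dots,N_{m-1}\in\mathbb{N}$ (positive integers) with $N_1+\dots+N_{m-1}=n-1$, and set $N_m:=1$. Put $N_i':=N_1+\dots+N_i$ and $N_0':=0$. The coordinates of $x=(x_1,\dots,x_n)\in\mathbb{R}^n$ are split into groups $X_i:=(x_{N_{i-1}'+1},\dots,x_{N_i'})\in\mathbb{R}^{N_i}$ for $i\in\{1,\dots,m-1\}$, and $X_m:=x_n$. For $y=(y_1,\dots,y_{N_i})\in\mathbb{R}^{N_i}$ let $y^{(i)}:=y_1e_{N_{i-1}'+1}+\dots+y_{N_i}e_{N_i'}\in\mathbb{R}^n$. For $s_i\in(0,1]$, define: if $s_i=1$, $(-\Delta_{X_i})^{s_i}u(x):=-\partial^2_{x_{N_{i-1}'+1}}u(x)-\dots-\partial^2_{x_{N_i'}}u(x)$; if $s_i\in(0,1)$, $$(-\Delta_{X_i})^{s_i}u(x):=c_{N_i,s_i}\int_{\mathbb{R}^{N_i}}\frac{2u(x)-u(x+y^{(i)})-u(x-y^{(i)})}{|y^{(i)}|^{N_i+2s_i}}\,dy,\qquad c_{N,s}:=\frac{2^{2s-1}\,\Gamma(s+\frac N2)}{\pi^{N/2}\,|\Gamma(-s)|}.$$ Given $a_1,\dots,a_{m-1}\ge0$, $a>0$ and $s_1,\dots,s_{m-1}\in(0,1]$, set $a_m:=a$, $s_m:=1$ and $$L:=\sum_{i=1}^{m-1}a_i(-\Delta_{X_i})^{s_i}-a\,\partial^2_{x_n}=\sum_{i=1}^m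 a_i(-\Delta_{X_i})^{s_i}.$$ Solutions are classical: "$u:\mathbb{R}^n\to\mathbb{R}$ is a solution of $Lu=f$ in $\Omega$" means that $u$ is continuous and smooth enough for $Lu(x)$ to be computed pointwise at every $x\in\Omega$, and $Lu(x)=f(x)$ there. Let $B^N_r$ be the open ball of $\mathbb{R}^N$ centered at the origin with radius $r$. For $\kappa>0$, $$Q_d:=B^{N_1}_{d_1}\times\dots\times B^{N_{m-1}}_{d_{m-1}}\times(-d_m,d_m),\qquad Q_{d,\kappa}:=B^{N_1}_{d_1}\times\dots\times B^{N_{m-1}}_{d_{m-1}}\times(-\kappa d_m,\kappa d_m).$$ For $i\in\{1,\dots,m\}$, $$\eta_i:=\frac{\Gamma(\frac{N_i}{2})}{2^{2s_i}\,\Gamma(s_i+1)\,\Gamma(s_i+\frac{N_i}{2})}.$$ The right-hand side of the estimate is understood in $[0,+\infty]$. *)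

theory Defs
  imports "HOL-Analysis.Analysis" "HOL-Probability.Essential_Supremum"
begin

text \<open>
  Conventions. The Euclidean basis is an enumeration \<open>e 1, \<dots>, e n\<close> of \<^term>\<open>Basis\<close>, so that the
  \<open>k\<close>-th coordinate of \<open>x\<close> is \<open>x \<bullet> e k\<close>; all families (\<open>e\<close>, \<open>N\<close>, \<open>a\<close>, \<open>s\<close>, \<open>d\<close>) are indexed from 1.
  Since the dimensions \<open>N i\<close> vary with \<open>i\<close>, the space of dimension \<open>k\<close> is represented by the
  functions in \<open>{1..k} \<rightarrow>\<^sub>E UNIV\<close>, with Euclidean norm \<open>L2_set y {1..k}\<close> and Lebesgue measure
  \<open>Pi\<^sub>M {1..k} (\<lambda>_. lborel)\<close>.
\<close>

definition offset :: "(nat \<Rightarrow> nat) \<Rightarrow> nat \<Rightarrow> nat" where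
  "offset N i = (\<Sum>k=1..i. N k)"

definition group_coords ::
    "(nat \<Rightarrow> 'a::euclidean_space) \<Rightarrow> (nat \<Rightarrow> nat) \<Rightarrow> nat \<Rightarrow> 'a \<Rightarrow> (nat \<Rightarrow> real)" where
  "group_coords e N i x = (\<lambda>j\<in>{1..N i}. x \<bullet> e (offset N (i - 1) + j))"

definition group_embed ::
    "(nat \<Rightarrow> 'a::euclidean_space) \<Rightarrow> (nat \<Rightarrow> nat) \<Rightarrow> nat \<Rightarrow> (nat \<Rightarrow> real) \<Rightarrow> 'a" where
  "group_embed e N i y = (\<Sum>j=1..N i. y j *\<^sub>R e (offset N (i - 1) + j))"

definition eball :: "nat \<Rightarrow> real \<Rightarrow> (nat \<Rightarrow> real) set" where
  "eball k r = {y \<in> {1..k} \<rightarrow>\<^sub>E UNIV. L2_set y {1..k} < r}"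

definition dir_deriv :: "'a::real_normed_vector \<Rightarrow> ('a \<Rightarrow> real) \<Rightarrow> 'a \<Rightarrow> real" where
  "dir_deriv v u x = deriv (\<lambda>h. u (x + h *\<^sub>R v)) 0"

definition dir_differentiable :: "'a::real_normed_vector \<Rightarrow> ('a \<Rightarrow> real) \<Rightarrow> 'a \<Rightarrow> bool" where
  "dir_differentiable v u x \<longleftrightarrow> (\<lambda>h::real. u (x + h *\<^sub>R v)) differentiable (at 0)"

definition dir_twice_differentiable :: "'a::real_normed_vector \<Rightarrow> ('a \<Rightarrow> real) \<Rightarrow> 'a \<Rightarrow> bool" where
  "dir_twice_differentiable v u x \<longleftrightarrow>
     (\<forall>\<^sub>F h in nhds (0::real). dir_differentiable v u (x + h *\<^sub>R v)) \<and>
     dir_differentiable v (dir_deriv v u) x"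

definition frac_const :: "nat \<Rightarrow> real \<Rightarrow> real" where
  "frac_const k s =
     2 powr (2 * s - 1) * Gamma (s + real k / 2) / (pi powr (real k / 2) * \<bar>Gamma (- s)\<bar>)"

definition frac_integrand ::
    "(nat \<Rightarrow> 'a::euclidean_space) \<Rightarrow> (nat \<Rightarrow> nat) \<Rightarrow> nat \<Rightarrow> real \<Rightarrow> ('a \<Rightarrow> real) \<Rightarrow> 'a \<Rightarrow>
      (nat \<Rightarrow> real) \<Rightarrow> real" where
  "frac_integrand e N i \<sigma> u x y =
     (2 * u x - u (x + group_embed e N i y) - u (x - group_embed e N i y))
       / norm (group_embed e N i y) powr (real (N i) + 2 * \<sigma>)"

definition frac_lap ::
    "(nat \<Rightarrow> 'a::euclidean_space) \<Rightarrow> (nat \<Rightarrow> nat) \<Rightarrow> nat \<Rightarrow> real \<Rightarrow> ('a \<Rightarrow> real) \<Rightarrow> 'a \<Rightarrow> real" where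
  "frac_lap e N i \<sigma> u x =
     (if \<sigma> = 1
      then \<Sum>j=1..N i. - dir_deriv (e (offset N (i - 1) + j))
                           (dir_deriv (e (offset N (i - 1) + j)) u) x
      else frac_const (N i) \<sigma>
             * (\<integral>y. frac_integrand e N i \<sigma> u x y \<partial>(Pi\<^sub>M {1..N i} (\<lambda>_. lborel))))"

text \<open>
  Both \<^const>\<open>deriv\<close> and the Bochner integral are total functions, so the well-definedness of
  \<^const>\<open>frac_lap\<close> has to be stated separately.
\<close>

definition frac_lap_defined ::
    "(nat \<Rightarrow> 'a::euclidean_space) \<Rightarrow> (nat \<Rightarrow> nat) \<Rightarrow> nat \<Rightarrow> real \<Rightarrow> ('a \<Rightarrow> real) \<Rightarrow> 'a \<Rightarrow> bool" where
  "frac_lap_defined e N i \<sigma> u x \<longleftrightarrow>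
     (if \<sigma> = 1
      then \<forall>j\<in>{1..N i}. dir_twice_differentiable (e (offset N (i - 1) + j)) u x
      else integrable (Pi\<^sub>M {1..N i} (\<lambda>_. lborel)) (frac_integrand e N i \<sigma> u x))"

definition aniso_op ::
    "nat \<Rightarrow> (nat \<Rightarrow> 'a::euclidean_space) \<Rightarrow> (nat \<Rightarrow> nat) \<Rightarrow> (nat \<Rightarrow> real) \<Rightarrow> (nat \<Rightarrow> real) \<Rightarrow>
      ('a \<Rightarrow> real) \<Rightarrow> 'a \<Rightarrow> real" where
  "aniso_op m e N a s u x = (\<Sum>i=1..m. a i * frac_lap e N i (s i) u x)"

text \<open>
  Terms with \<open>a i = 0\<close> do not occur in the operator, and no regularity in the corresponding
  directions is required of a solution.
\<close>

definition classical_solution ::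
    "nat \<Rightarrow> (nat \<Rightarrow> 'a::euclidean_space) \<Rightarrow> (nat \<Rightarrow> nat) \<Rightarrow> (nat \<Rightarrow> real) \<Rightarrow> (nat \<Rightarrow> real) \<Rightarrow>
      ('a \<Rightarrow> real) \<Rightarrow> 'a set \<Rightarrow> ('a \<Rightarrow> real) \<Rightarrow> bool" where
  "classical_solution m e N a s f \<Omega> u \<longleftrightarrow>
     continuous_on UNIV u \<and>
     (\<forall>x\<in>\<Omega>. (\<forall>i\<in>{1..m}. a i \<noteq> 0 \<longrightarrow> frac_lap_defined e N i (s i) u x) \<and>
            aniso_op m e N a s u x = f x)"

definition cyl ::
    "nat \<Rightarrow> nat \<Rightarrow> (nat \<Rightarrow> 'a::euclidean_space) \<Rightarrow> (nat \<Rightarrow> nat) \<Rightarrow> (nat \<Rightarrow> real) \<Rightarrow> real \<Rightarrow> 'a set" where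
  "cyl n m e N d \<kappa> =
     {x. (\<forall>i\<in>{1..<m}. group_coords e N i x \<in> eball (N i) (d i)) \<and>
         x \<bullet> e n \<in> {- (\<kappa> * d m)<..<\<kappa> * d m}}"

definition eta :: "nat \<Rightarrow> real \<Rightarrow> real" where
  "eta k s = Gamma (real k / 2) / (2 powr (2 * s) * Gamma (s + 1) * Gamma (s + real k / 2))"

definition Linf_norm :: "('a::euclidean_space \<Rightarrow> real) \<Rightarrow> ennreal" where
  "Linf_norm u = esssup lborel (\<lambda>x. ennreal \<bar>u x\<bar>)"

end

theory Submission
  imports Defs "HOL-Probability.Distributions"
begin

text \<open>
  Let \<open>u\<^sup>*\<close> be \<open>u\<close> reflected in the hyperplane \<open>x\<^sub>n = 0\<close> and \<open>v = u - u\<^sup>*\<close>. Then \<open>v\<close> vanishes on this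
  hyperplane, \<open>\<bar>v\<bar> \<le> 2 M\<close> with \<open>M\<close> the sup norm of \<open>u\<close>, and \<open>L v\<close> is the corresponding odd part of \<open>f\<close>,
  hence is bounded by \<open>S\<close> on the cylinder. The claim is a bound of \<open>v (t e\<^sub>n)\<close> linear in \<open>\<bar>t\<bar>\<close>, and
  it follows by comparison with a barrier on \<open>0 \<le> \<tau> \<le> d\<^sub>m\<close>, \<open>\<tau> = \<bar>x\<^sub>n\<bar>\<close>:
  \<open>\<phi> = 2 M \<tau> / d\<^sub>m + (K / 2) \<tau> (d\<^sub>m - \<tau>)
       + (2 M / (1 - e\<^sup>-\<^sup>1)) \<Sum>\<^bsub>i<m\<^esub> (1 - exp (- \<bar>X\<^sub>i\<bar>\<^sup>2 / d\<^sub>i\<^sup>2))\<close>.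
  The first term dominates \<open>v\<close> where \<open>\<tau> = d\<^sub>m\<close>, the last one where some \<open>\<bar>X\<^sub>i\<bar> \<ge> d\<^sub>i\<close>, and the middle
  one contributes \<open>a\<^sub>m K\<close> to \<open>L \<phi>\<close>. On the \<open>x\<^sub>n\<close>-axis the last term vanishes, so that there
  \<open>\<phi> \<le> \<tau> (2 M / d\<^sub>m + K d\<^sub>m / 2)\<close>, and \<open>2 M / d\<^sub>m \<le> M d\<^sub>m / \<mu>\<close> because
  \<open>\<eta>\<^sub>m = 1 / 2\<close>. This gives the asserted bound if \<open>K\<close> is chosen with
  \<open>a\<^sub>m K = S + 4 M (a\<^sub>1 + \<dots> + a\<^sub>m) / \<mu>\<close>, \<open>\<mu>\<close> being the minimum of the \<open>\<eta>\<^sub>i d\<^sub>i\<^bsup>2 s\<^sub>i\<^esup>\<close>.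

  What has to be known is how negative \<open>(-\<Delta>)\<^sup>s\<close> of the last term can be. For a Gaussian
  \<open>G x = e\<^bsup>-\<beta> \<bar>x\<bar>\<^sup>2\<^esup>\<close> the parallelogram law gives, pointwise in \<open>x\<close> and \<open>y\<close>,
  \<open>2 G x - G (x + y) - G (x - y) \<le> 2 (1 - e\<^bsup>-\<beta> \<bar>y\<bar>\<^sup>2\<^esup>)\<close>, that is, the second differences are
  largest at the origin (\<open>gaussian_second_difference_le\<close>). At the origin the singular integral can be
  computed by writing every factor as a superposition of exponentials
  (\<open>nn_integral_gaussian_second_difference\<close>), and the result is
  \<open>\<beta>\<^sup>s / (\<eta> \<Gamma>(1 + s))\<close>. The Gaussian thus replaces the explicit solution
  \<open>(1 - \<bar>x\<bar>\<^sup>2)\<^sup>s\<close> of the torsion problem in the ball, at the price of the factor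
  \<open>1 / ((1 - e\<^sup>-\<^sup>1) \<Gamma>(1 + s))\<close>, and this factor is at most \<open>2\<close> for all \<open>s\<close>
  (\<open>inverse_one_minus_exp_le\<close>). Hence each \<open>a\<^sub>i (-\<Delta>)\<^sup>s\<close> costs at most \<open>4 M a\<^sub>i / \<mu>\<close>, and
  \<open>L \<phi> \<ge> S + 4 M a\<^sub>m / \<mu>\<close>, which exceeds \<open>S\<close> when \<open>M > 0\<close>.

  If \<open>v - \<phi>\<close> were positive somewhere, it would have a positive maximum at an interior point of
  the cylinder. There all second differences of \<open>v\<close> are at least those of \<open>\<phi>\<close>, hence
  \<open>L v \<ge> L \<phi> > S\<close>, a contradiction (\<open>odd_part_le_barrier\<close>). This compares second differences only, so
  fractional and classical Laplacians are treated alike: second differences are integrated in the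
  fractional case, and taken with step \<open>h \<rightarrow> 0\<close> otherwise (\<open>frac_lap_diff_ge\<close>).
\<close>

section \<open>A radial singular integral\<close>

lemma nn_integral_powr_exp:
  fixes p q :: real
  assumes p: "p > 0" and q: "q > 0"
  shows "(\<integral>\<^sup>+\<tau>. ennreal (\<tau> powr (p - 1) * exp (- (q * \<tau>))) * indicator {0<..} \<tau> \<partial>lborel)
           = ennreal (Gamma p / q powr p)"
proof -
  let ?f = "\<lambda>t::real. ennreal (indicator {0..} t * t powr (p - 1) / exp t)"
  let ?J = "\<integral>\<^sup>+\<tau>. ennreal (\<tau> powr (p - 1) * exp (- (q * \<tau>))) * indicator {0<..} \<tau> \<partial>lborel"
  have "ennreal (Gamma p) = (\<integral>\<^sup>+t. ?f t \<partial>lborel)"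
    by (rule Gamma_conv_nn_integral_real[OF p])
  also have "\<dots> = ennreal q * (\<integral>\<^sup>+t. ?f (0 + q * t) \<partial>lborel)"
    using q by (subst nn_integral_real_affine[where c = q and t = 0]) auto
  also have "(\<integral>\<^sup>+t. ?f (0 + q * t) \<partial>lborel) = (\<integral>\<^sup>+t. ennreal (q powr (p - 1)) *
      (ennreal (t powr (p - 1) * exp (- (q * t))) * indicator {0<..} t) \<partial>lborel)"
  proof (intro nn_integral_cong)
    fix t :: real
    consider "t > 0" | "t = 0" | "t < 0" by linarith
    then show "?f (0 + q * t) = ennreal (q powr (p - 1)) *
      (ennreal (t powr (p - 1) * exp (- (q * t))) * indicator {0<..} t)"
    proof cases
      case 1
      then show ?thesis using q
        by (simp add: powr_mult exp_minus divide_inverse ennreal_mult'[symmetric] ac_simps)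
    next
      case 3
      then have "\<not> 0 \<le> q * t" using q by (simp add: mult_le_0_iff not_le mult_pos_neg)
      then show ?thesis using 3 by simp
    qed simp
  qed
  also have "\<dots> = ennreal (q powr (p - 1)) * ?J"
    by (rule nn_integral_cmult) measurable
  finally have *: "ennreal (Gamma p) = ennreal (q powr p) * ?J"
    using q by (simp add: mult.assoc[symmetric] ennreal_mult'[symmetric] powr_mult_base)
  have "ennreal (Gamma p / q powr p) = ennreal (1 / q powr p) * ennreal (Gamma p)"
    using p q by (simp add: ennreal_mult'[symmetric] Gamma_real_pos less_imp_le)
  also have "\<dots> = ?J"
    unfolding * using q by (simp add: mult.assoc[symmetric] ennreal_mult'[symmetric])
  finally show ?thesis by simp
qed

lemma nn_integral_gaussian_PiM:
  fixes \<mu> :: real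
  assumes I: "finite I" and \<mu>: "\<mu> > 0"
  shows "(\<integral>\<^sup>+y. ennreal (exp (- (\<mu> * (\<Sum>i\<in>I. (y i)\<^sup>2)))) \<partial>Pi\<^sub>M I (\<lambda>_. lborel))
           = ennreal ((pi / \<mu>) powr (card I / 2))"
proof -
  interpret product_sigma_finite "\<lambda>_. lborel :: real measure" ..
  define \<sigma> where "\<sigma> = sqrt (1 / (2 * \<mu>))"
  have \<sigma>: "\<sigma> > 0" "\<sigma>\<^sup>2 = 1 / (2 * \<mu>)" using \<mu> by (auto simp: \<sigma>_def)
  interpret prob_space "density lborel (normal_density 0 \<sigma>)"
    using \<sigma>(1) by (rule prob_space_normal_density)
  have one: "(\<integral>\<^sup>+x. ennreal (normal_density 0 \<sigma> x) \<partial>lborel) = 1"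
    using emeasure_space_1 by (simp add: emeasure_density)
  have "(\<integral>\<^sup>+x. ennreal (exp (- (\<mu> * x\<^sup>2))) \<partial>lborel)
      = (\<integral>\<^sup>+x. ennreal (sqrt (pi / \<mu>)) * ennreal (normal_density 0 \<sigma> x) \<partial>lborel)"
    using \<mu> by (intro nn_integral_cong)
      (simp add: normal_density_def \<sigma> ennreal_mult'[symmetric] real_sqrt_divide field_simps)
  also have "\<dots> = ennreal (sqrt (pi / \<mu>))"
    using one by (subst nn_integral_cmult) auto
  finally have 1: "(\<integral>\<^sup>+x. ennreal (exp (- (\<mu> * x\<^sup>2))) \<partial>lborel) = ennreal (sqrt (pi / \<mu>))" .
  have "(\<integral>\<^sup>+y. ennreal (exp (- (\<mu> * (\<Sum>i\<in>I. (y i)\<^sup>2)))) \<partial>Pi\<^sub>M I (\<lambda>_. lborel))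
      = (\<integral>\<^sup>+y. (\<Prod>i\<in>I. ennreal (exp (- (\<mu> * (y i)\<^sup>2)))) \<partial>Pi\<^sub>M I (\<lambda>_. lborel))"
    using I by (simp add: prod_ennreal exp_sum sum_distrib_left sum_negf[symmetric])
  also have "\<dots> = (\<Prod>i\<in>I. ennreal (sqrt (pi / \<mu>)))"
    using I by (subst product_nn_integral_prod) (auto simp: 1)
  also have "\<dots> = ennreal ((pi / \<mu>) powr (card I / 2))"
    using \<mu> by (simp add: ennreal_power powr_half_sqrt[symmetric] powr_powr powr_realpow[symmetric])
  finally show ?thesis .
qed

text \<open>
  Integration in polar coordinates, for the integrand \<open>e\<^bsup>-\<mu> \<bar>y\<bar>\<^sup>2\<^esup>\<close> and with \<open>r = \<bar>y\<bar>\<^sup>2\<close> as radial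
  variable: both sides are explicit. All other radial integrands below are superpositions of such
  exponentials, which reduces their integrals to one-dimensional ones.
\<close>
lemma nn_integral_radial_exp:
  fixes \<mu> :: real
  assumes I: "finite I" "I \<noteq> {}" and \<mu>: "\<mu> > 0"
  shows "(\<integral>\<^sup>+y. ennreal (exp (- (\<mu> * (\<Sum>i\<in>I. (y i)\<^sup>2)))) \<partial>Pi\<^sub>M I (\<lambda>_. lborel))
           = ennreal (pi powr (card I / 2) / Gamma (card I / 2)) *
             (\<integral>\<^sup>+r. ennreal (r powr (card I / 2 - 1) * exp (- (\<mu> * r))) * indicator {0<..} r \<partial>lborel)"
proof -
  have k: "real (card I) / 2 > 0" using I by (simp add: card_gt_0_iff)
  then have "Gamma (real (card I) / 2) > 0" by (rule Gamma_real_pos)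
  then show ?thesis
    unfolding nn_integral_gaussian_PiM[OF I(1) \<mu>] nn_integral_powr_exp[OF k \<mu>] using \<mu>
    by (subst ennreal_mult'[symmetric]) (auto simp: powr_divide)
qed

lemma nn_integral_radial_exp_diff:
  fixes \<tau> \<beta> :: real
  assumes I: "finite I" "I \<noteq> {}" and \<tau>: "\<tau> > 0" and \<beta>: "\<beta> > 0"
  shows "(\<integral>\<^sup>+y. ennreal (exp (- (\<tau> * (\<Sum>i\<in>I. (y i)\<^sup>2))) * (1 - exp (- (\<beta> * (\<Sum>i\<in>I. (y i)\<^sup>2)))))
             \<partial>Pi\<^sub>M I (\<lambda>_. lborel))
           = ennreal (pi powr (card I / 2) / Gamma (card I / 2)) *
             (\<integral>\<^sup>+r. ennreal (r powr (card I / 2 - 1) * exp (- (\<tau> * r)) * (1 - exp (- (\<beta> * r))))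
                * indicator {0<..} r \<partial>lborel)"
    (is "?L = ennreal ?c * ?R")
proof -
  let ?q = "\<lambda>y. \<Sum>i\<in>I. (y i)\<^sup>2 :: real"
  let ?M = "Pi\<^sub>M I (\<lambda>_. lborel :: real measure)"
  let ?E = "\<lambda>\<mu> y. ennreal (exp (- (\<mu> * ?q y)))"
  let ?e = "\<lambda>\<mu> r. ennreal (r powr (card I / 2 - 1) * exp (- (\<mu> * r))) * indicator {0<..} r"
  have k: "real (card I) / 2 > 0" using I by (simp add: card_gt_0_iff)
  have fin: "integral\<^sup>N lborel (?e (\<tau> + \<beta>)) \<noteq> \<infinity>" "integral\<^sup>N ?M (?E (\<tau> + \<beta>)) \<noteq> \<infinity>"
    using \<tau> \<beta> by (simp_all add: nn_integral_powr_exp[OF k] nn_integral_gaussian_PiM[OF I(1)])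
  have split_exp: "exp (- (\<tau> * q)) * (1 - exp (- (\<beta> * q)))
      = exp (- (\<tau> * q)) - exp (- ((\<tau> + \<beta>) * q))" for q
    by (simp add: algebra_simps flip: exp_add)
  \<comment> \<open>Subtraction on ennreal is well-behaved here because both subtracted integrals are finite.\<close>
  have "?L = (\<integral>\<^sup>+y. ?E \<tau> y - ?E (\<tau> + \<beta>) y \<partial>?M)"
    unfolding split_exp by (intro nn_integral_cong) (simp add: ennreal_minus)
  also have "\<dots> = integral\<^sup>N ?M (?E \<tau>) - integral\<^sup>N ?M (?E (\<tau> + \<beta>))"
    using fin \<beta> I(1)
    by (intro nn_integral_diff) (auto intro!: AE_I2 ennreal_leI mult_right_mono sum_nonneg)
  also have "\<dots> = ennreal ?c * (integral\<^sup>N lborel (?e \<tau>) - integral\<^sup>N lborel (?e (\<tau> + \<beta>)))"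
    using \<tau> \<beta> by (simp add: nn_integral_radial_exp[OF I] ennreal_right_diff_distrib)
  also have "integral\<^sup>N lborel (?e \<tau>) - integral\<^sup>N lborel (?e (\<tau> + \<beta>))
      = (\<integral>\<^sup>+r. ?e \<tau> r - ?e (\<tau> + \<beta>) r \<partial>lborel)"
    using fin \<beta> by (intro nn_integral_diff[symmetric])
      (auto intro!: AE_I2 ennreal_leI mult_left_mono mult_right_mono split: split_indicator)
  also have "\<dots> = ?R"
    by (intro nn_integral_cong)
       (auto simp: ennreal_minus mult.assoc split_exp right_diff_distrib[symmetric] split: split_indicator)
  finally show ?thesis .
qed

text \<open>
  The polar formula for \<open>(1 - e\<^bsup>-\<beta> \<bar>y\<bar>\<^sup>2\<^esup>) / \<bar>y\<bar>\<^bsup>2 p\<^esup>\<close>. The negative power is the superposition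
  \<open>\<Gamma>(p)\<^sup>-\<^sup>1 \<integral> \<tau>\<^bsup>p - 1\<^esup> e\<^bsup>-\<tau> \<bar>y\<bar>\<^sup>2\<^esup> d\<tau>\<close>; after interchanging the integrals the formula is known for
  the inner integrand, and interchanging back restores the power, now of \<open>r\<close>.
\<close>
lemma nn_integral_radial_frac_profile:
  fixes \<beta> p :: real
  assumes I: "finite I" "I \<noteq> {}" and \<beta>: "\<beta> > 0" and p: "p > 0"
  shows "(\<integral>\<^sup>+y. ennreal ((1 - exp (- (\<beta> * (\<Sum>i\<in>I. (y i)\<^sup>2)))) / (\<Sum>i\<in>I. (y i)\<^sup>2) powr p)
             \<partial>Pi\<^sub>M I (\<lambda>_. lborel))
           \<le> ennreal (pi powr (card I / 2) / Gamma (card I / 2)) *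
             (\<integral>\<^sup>+r. ennreal (r powr (card I / 2 - 1 - p) * (1 - exp (- (\<beta> * r))))
                * indicator {0<..} r \<partial>lborel)"
    (is "?L \<le> ennreal ?c * ?R")
proof -
  let ?q = "\<lambda>y. \<Sum>i\<in>I. (y i)\<^sup>2 :: real"
  let ?M = "Pi\<^sub>M I (\<lambda>_. lborel :: real measure)"
  let ?h = "\<lambda>\<tau>. \<tau> powr (p - 1) / Gamma p"
  let ?k = "real (card I) / 2"
  interpret sf: product_sigma_finite "\<lambda>_. lborel :: real measure" ..
  interpret M: sigma_finite_measure ?M by (rule sf.sigma_finite[OF I(1)])
  interpret pM: pair_sigma_finite ?M "lborel :: real measure" ..
  have Gp: "Gamma p > 0" using p by (rule Gamma_real_pos)
  have mix: "ennreal (1 / q powr p)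
      = (\<integral>\<^sup>+\<tau>. ennreal (?h \<tau> * exp (- (\<tau> * q))) * indicator {0<..} \<tau> \<partial>lborel)"
    if q: "q > 0" for q
  proof -
    have "(\<integral>\<^sup>+\<tau>. ennreal (?h \<tau> * exp (- (\<tau> * q))) * indicator {0<..} \<tau> \<partial>lborel)
        = (\<integral>\<^sup>+\<tau>. ennreal (1 / Gamma p) *
            (ennreal (\<tau> powr (p - 1) * exp (- (q * \<tau>))) * indicator {0<..} \<tau>) \<partial>lborel)"
      using Gp by (intro nn_integral_cong)
        (auto simp: ennreal_mult'[symmetric] mult.assoc[symmetric] mult.commute split: split_indicator)
    also have "\<dots> = ennreal (1 / Gamma p) * ennreal (Gamma p / q powr p)"
      by (subst nn_integral_cmult) (auto simp: nn_integral_powr_exp[OF p q])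
    also have "\<dots> = ennreal (1 / q powr p)"
      using Gp by (subst ennreal_mult'[symmetric]) auto
    finally show ?thesis by simp
  qed
  have mix': "ennreal (b / q powr p)
      = (\<integral>\<^sup>+\<tau>. ennreal (?h \<tau> * exp (- (\<tau> * q)) * b) * indicator {0<..} \<tau> \<partial>lborel)"
    if q: "q > 0" and b: "b \<ge> 0" for q b
  proof -
    have "ennreal (b / q powr p) = ennreal b * ennreal (1 / q powr p)"
      using b by (simp add: ennreal_mult'[symmetric])
    also have "\<dots> = (\<integral>\<^sup>+\<tau>. ennreal b * (ennreal (?h \<tau> * exp (- (\<tau> * q))) * indicator {0<..} \<tau>) \<partial>lborel)"
      unfolding mix[OF q] by (rule nn_integral_cmult[symmetric]) measurable
    also have "\<dots> = (\<integral>\<^sup>+\<tau>. ennreal (?h \<tau> * exp (- (\<tau> * q)) * b) * indicator {0<..} \<tau> \<partial>lborel)"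
      using b by (intro nn_integral_cong)
        (auto simp: ennreal_mult'[symmetric] mult.commute split: split_indicator)
    finally show ?thesis .
  qed
  \<comment> \<open>At \<open>y = 0\<close> the left integrand is \<open>0\<close>, since division by \<open>0\<close> gives \<open>0\<close>.\<close>
  have "?L \<le> (\<integral>\<^sup>+y. (\<integral>\<^sup>+\<tau>. ennreal (?h \<tau> * exp (- (\<tau> * ?q y)) * (1 - exp (- (\<beta> * ?q y))))
            * indicator {0<..} \<tau> \<partial>lborel) \<partial>?M)"
  proof (intro nn_integral_mono)
    fix y :: "'a \<Rightarrow> real"
    have "?q y \<ge> 0" by (intro sum_nonneg) auto
    then consider "?q y = 0" | "?q y > 0" by linarith
    then show "ennreal ((1 - exp (- (\<beta> * ?q y))) / ?q y powr p)
      \<le> (\<integral>\<^sup>+\<tau>. ennreal (?h \<tau> * exp (- (\<tau> * ?q y)) * (1 - exp (- (\<beta> * ?q y))))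
            * indicator {0<..} \<tau> \<partial>lborel)"
    proof cases
      case 2
      then show ?thesis using \<beta> by (subst mix') auto
    qed simp
  qed
  also have "\<dots> = (\<integral>\<^sup>+\<tau>. (\<integral>\<^sup>+y. ennreal (?h \<tau> * exp (- (\<tau> * ?q y)) * (1 - exp (- (\<beta> * ?q y))))
            * indicator {0<..} \<tau> \<partial>?M) \<partial>lborel)"
    by (rule pM.Fubini'[symmetric]) (use I in measurable)
  also have "\<dots> = (\<integral>\<^sup>+\<tau>. ennreal ?c * (\<integral>\<^sup>+r. ennreal (?h \<tau> * r powr (?k - 1) * exp (- (\<tau> * r))
            * (1 - exp (- (\<beta> * r)))) * indicator {0<..} r * indicator {0<..} \<tau> \<partial>lborel) \<partial>lborel)"
  proof (intro nn_integral_cong)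
    fix \<tau> :: real
    show "(\<integral>\<^sup>+y. ennreal (?h \<tau> * exp (- (\<tau> * ?q y)) * (1 - exp (- (\<beta> * ?q y))))
            * indicator {0<..} \<tau> \<partial>?M)
        = ennreal ?c * (\<integral>\<^sup>+r. ennreal (?h \<tau> * r powr (?k - 1) * exp (- (\<tau> * r))
            * (1 - exp (- (\<beta> * r)))) * indicator {0<..} r * indicator {0<..} \<tau> \<partial>lborel)"
    proof (cases "\<tau> > 0")
      case True
      have h: "?h \<tau> \<ge> 0" using Gp by simp
      have "(\<integral>\<^sup>+y. ennreal (?h \<tau> * exp (- (\<tau> * ?q y)) * (1 - exp (- (\<beta> * ?q y))))
            * indicator {0<..} \<tau> \<partial>?M)
          = (\<integral>\<^sup>+y. ennreal (?h \<tau>) * ennreal (exp (- (\<tau> * ?q y)) * (1 - exp (- (\<beta> * ?q y)))) \<partial>?M)"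
        using True h by (intro nn_integral_cong) (simp add: ennreal_mult'[symmetric] mult.assoc)
      also have "\<dots> = ennreal (?h \<tau>) * (ennreal ?c * (\<integral>\<^sup>+r. ennreal (r powr (?k - 1) * exp (- (\<tau> * r))
            * (1 - exp (- (\<beta> * r)))) * indicator {0<..} r \<partial>lborel))"
        by (subst nn_integral_cmult) (use I in \<open>auto simp: nn_integral_radial_exp_diff[OF I True \<beta>]\<close>)
      also have "\<dots> = ennreal ?c * (\<integral>\<^sup>+r. ennreal (?h \<tau>) * (ennreal (r powr (?k - 1) * exp (- (\<tau> * r))
            * (1 - exp (- (\<beta> * r)))) * indicator {0<..} r) \<partial>lborel)"
        by (subst nn_integral_cmult) (auto simp: ac_simps)
      also have "(\<integral>\<^sup>+r. ennreal (?h \<tau>) * (ennreal (r powr (?k - 1) * exp (- (\<tau> * r))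
            * (1 - exp (- (\<beta> * r)))) * indicator {0<..} r) \<partial>lborel)
          = (\<integral>\<^sup>+r. ennreal (?h \<tau> * r powr (?k - 1) * exp (- (\<tau> * r))
            * (1 - exp (- (\<beta> * r)))) * indicator {0<..} r * indicator {0<..} \<tau> \<partial>lborel)"
        using True h by (intro nn_integral_cong)
          (auto simp: ennreal_mult'[symmetric] mult.assoc split: split_indicator)
      finally show ?thesis .
    qed simp
  qed
  also have "\<dots> = ennreal ?c * (\<integral>\<^sup>+\<tau>. (\<integral>\<^sup>+r. ennreal (?h \<tau> * r powr (?k - 1) * exp (- (\<tau> * r))
            * (1 - exp (- (\<beta> * r)))) * indicator {0<..} r * indicator {0<..} \<tau> \<partial>lborel) \<partial>lborel)"
    by (rule nn_integral_cmult) measurable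
  also have "(\<integral>\<^sup>+\<tau>. (\<integral>\<^sup>+r. ennreal (?h \<tau> * r powr (?k - 1) * exp (- (\<tau> * r))
            * (1 - exp (- (\<beta> * r)))) * indicator {0<..} r * indicator {0<..} \<tau> \<partial>lborel) \<partial>lborel)
     = (\<integral>\<^sup>+r. (\<integral>\<^sup>+\<tau>. ennreal (?h \<tau> * r powr (?k - 1) * exp (- (\<tau> * r))
            * (1 - exp (- (\<beta> * r)))) * indicator {0<..} r * indicator {0<..} \<tau> \<partial>lborel) \<partial>lborel)"
    by (rule lborel_pair.Fubini') measurable
  also have "\<dots> = ?R"
  proof (intro nn_integral_cong)
    fix r :: real
    show "(\<integral>\<^sup>+\<tau>. ennreal (?h \<tau> * r powr (?k - 1) * exp (- (\<tau> * r))
            * (1 - exp (- (\<beta> * r)))) * indicator {0<..} r * indicator {0<..} \<tau> \<partial>lborel)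
        = ennreal (r powr (?k - 1 - p) * (1 - exp (- (\<beta> * r)))) * indicator {0<..} r"
    proof (cases "r > 0")
      case True
      have "(\<integral>\<^sup>+\<tau>. ennreal (?h \<tau> * r powr (?k - 1) * exp (- (\<tau> * r))
            * (1 - exp (- (\<beta> * r)))) * indicator {0<..} r * indicator {0<..} \<tau> \<partial>lborel)
          = ennreal (r powr (?k - 1) * (1 - exp (- (\<beta> * r))) / r powr p)"
        using True \<beta> by (subst mix') (auto simp: ac_simps intro!: nn_integral_cong)
      also have "r powr (?k - 1) * (1 - exp (- (\<beta> * r))) / r powr p
          = r powr (?k - 1 - p) * (1 - exp (- (\<beta> * r)))"
        by (simp add: powr_diff[of r "?k - 1" p])
      finally show ?thesis using True by simp
    qed simp
  qed
  finally show ?thesis .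
qed

lemma nn_integral_powr_from_0:
  fixes s \<beta> :: real
  assumes s: "s > 0" and \<beta>: "\<beta> > 0"
  shows "(\<integral>\<^sup>+\<theta>. ennreal (\<theta> powr (s - 1)) * indicator {0..\<beta>} \<theta> \<partial>lborel) = ennreal (\<beta> powr s / s)"
proof -
  have "((\<lambda>\<theta>. \<theta> powr (s - 1)) has_integral (\<beta> powr s / s - 0 powr s / s)) {0..\<beta>}"
    using s \<beta>
    by (intro fundamental_theorem_of_calculus_interior)
       (auto intro!: continuous_intros continuous_on_powr' derivative_eq_intros
             simp flip: has_real_derivative_iff_has_vector_derivative)
  then have "(\<integral>\<^sup>+\<theta>. ennreal (indicator {0..\<beta>} \<theta> * \<theta> powr (s - 1)) \<partial>lborel) = ennreal (\<beta> powr s / s)"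
    by (intro nn_integral_has_integral_lebesgue) (auto simp: s)
  then show ?thesis
    by (simp add: indicator_mult_ennreal mult.commute)
qed

text \<open>
  Since \<open>1 - e\<^bsup>-\<beta> r\<^esup> = \<integral>\<^sub>0\<^sup>\<beta> r e\<^bsup>-\<theta> r\<^esup> d\<theta>\<close>, the integral over \<open>r\<close> becomes \<open>\<Gamma>(1 - s) \<theta>\<^bsup>s - 1\<^esup>\<close>.
\<close>
lemma nn_integral_one_minus_exp:
  fixes s \<beta> :: real
  assumes s: "0 < s" "s < 1" and \<beta>: "\<beta> > 0"
  shows "(\<integral>\<^sup>+r. ennreal (r powr (- 1 - s) * (1 - exp (- (\<beta> * r)))) * indicator {0<..} r \<partial>lborel)
           = ennreal (Gamma (1 - s) / s * \<beta> powr s)"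
proof -
  let ?F = "\<lambda>r \<theta>. ennreal (r powr (1 - s - 1) * exp (- (\<theta> * r))) * indicator {0<..} r * indicator {0..\<beta>} \<theta>"
  have "(\<integral>\<^sup>+r. ennreal (r powr (- 1 - s) * (1 - exp (- (\<beta> * r)))) * indicator {0<..} r \<partial>lborel)
      = (\<integral>\<^sup>+r. (\<integral>\<^sup>+\<theta>. ?F r \<theta> \<partial>lborel) \<partial>lborel)"
  proof (intro nn_integral_cong)
    fix r :: real
    show "ennreal (r powr (- 1 - s) * (1 - exp (- (\<beta> * r)))) * indicator {0<..} r
        = (\<integral>\<^sup>+\<theta>. ?F r \<theta> \<partial>lborel)"
    proof (cases "r > 0")
      case True
      have "r powr (- s) = r powr (- 1 - s) * r"
        using True powr_add[of r "- 1 - s" 1] by simp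
      have "(\<integral>\<^sup>+\<theta>. ennreal (r powr (- s) * exp (- (\<theta> * r))) * indicator {0..\<beta>} \<theta> \<partial>lborel)
          = (- (r powr (- 1 - s) * exp (- (\<beta> * r)))) - (- (r powr (- 1 - s) * exp (- (0 * r))))"
        using True \<beta> \<open>r powr (- s) = _\<close>
        by (intro nn_integral_FTC_Icc) (auto intro!: derivative_eq_intros)
      then show ?thesis using True by (simp add: algebra_simps)
    qed simp
  qed
  also have "\<dots> = (\<integral>\<^sup>+\<theta>. (\<integral>\<^sup>+r. ?F r \<theta> \<partial>lborel) \<partial>lborel)"
    by (rule lborel_pair.Fubini') measurable
  also have "\<dots> = (\<integral>\<^sup>+\<theta>. ennreal (Gamma (1 - s)) * (ennreal (\<theta> powr (s - 1)) * indicator {0..\<beta>} \<theta>) \<partial>lborel)"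
  proof (intro nn_integral_cong_AE, use AE_lborel_singleton[of "0::real"] in eventually_elim)
    case (elim \<theta>)
    show ?case
    proof (cases "0 < \<theta> \<and> \<theta> \<le> \<beta>")
      case True
      then have "(\<integral>\<^sup>+r. ?F r \<theta> \<partial>lborel) = ennreal (Gamma (1 - s) / \<theta> powr (1 - s))"
        using nn_integral_powr_exp[of "1 - s" \<theta>] s by simp
      also have "Gamma (1 - s) / \<theta> powr (1 - s) = Gamma (1 - s) * \<theta> powr (s - 1)"
        using powr_minus_divide[of \<theta> "1 - s"] by simp
      finally show ?thesis using True s by (simp add: ennreal_mult'[symmetric])
    qed (use elim in \<open>auto split: split_indicator\<close>)
  qed
  also have "\<dots> = ennreal (Gamma (1 - s)) * ennreal (\<beta> powr s / s)"
    by (subst nn_integral_cmult) (auto simp: nn_integral_powr_from_0 s \<beta>)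
  also have "\<dots> = ennreal (Gamma (1 - s) / s * \<beta> powr s)"
    using s by (subst ennreal_mult'[symmetric]) auto
  finally show ?thesis .
qed

text \<open>
  Up to the factor \<open>2\<close> and the normalizing constant, this is the fractional Laplacian of
  \<open>e\<^bsup>-\<beta> \<bar>y\<bar>\<^sup>2\<^esup>\<close> at the origin of a space of dimension \<open>card I\<close>.
\<close>
lemma nn_integral_gaussian_second_difference:
  fixes \<beta> s :: real
  assumes I: "finite I" "I \<noteq> {}" and \<beta>: "\<beta> > 0" and s: "0 < s" "s < 1"
  shows "(\<integral>\<^sup>+y. ennreal ((1 - exp (- (\<beta> * (\<Sum>i\<in>I. (y i)\<^sup>2)))) /
              sqrt (\<Sum>i\<in>I. (y i)\<^sup>2) powr (card I + 2 * s)) \<partial>Pi\<^sub>M I (\<lambda>_. lborel))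
           \<le> ennreal (pi powr (card I / 2) / Gamma (card I / 2) * (Gamma (1 - s) / s * \<beta> powr s))"
proof -
  let ?k = "real (card I) / 2"
  have k: "?k > 0" using I by (simp add: card_gt_0_iff)
  have "sqrt q powr (card I + 2 * s) = q powr (?k + s)" if "q \<ge> 0" for q
    using that by (simp add: powr_half_sqrt[symmetric] powr_powr field_simps)
  then have "(\<integral>\<^sup>+y. ennreal ((1 - exp (- (\<beta> * (\<Sum>i\<in>I. (y i)\<^sup>2)))) /
              sqrt (\<Sum>i\<in>I. (y i)\<^sup>2) powr (card I + 2 * s)) \<partial>Pi\<^sub>M I (\<lambda>_. lborel))
    = (\<integral>\<^sup>+y. ennreal ((1 - exp (- (\<beta> * (\<Sum>i\<in>I. (y i)\<^sup>2)))) /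
              (\<Sum>i\<in>I. (y i)\<^sup>2) powr (?k + s)) \<partial>Pi\<^sub>M I (\<lambda>_. lborel))"
    by (simp add: sum_nonneg)
  also have "\<dots> \<le> ennreal (pi powr ?k / Gamma ?k) *
             (\<integral>\<^sup>+r. ennreal (r powr (?k - 1 - (?k + s)) * (1 - exp (- (\<beta> * r))))
                * indicator {0<..} r \<partial>lborel)"
    using k s by (intro nn_integral_radial_frac_profile I \<beta>) auto
  also have "?k - 1 - (?k + s) = - 1 - s" by simp
  also have "ennreal (pi powr ?k / Gamma ?k) *
             (\<integral>\<^sup>+r. ennreal (r powr (- 1 - s) * (1 - exp (- (\<beta> * r)))) * indicator {0<..} r \<partial>lborel)
     = ennreal (pi powr ?k / Gamma ?k * (Gamma (1 - s) / s * \<beta> powr s))"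
    using Gamma_real_pos[OF k] by (simp add: nn_integral_one_minus_exp s \<beta> ennreal_mult'[symmetric])
  finally show ?thesis .
qed

section \<open>The normalizing constants\<close>

text \<open>
  By log-convexity, \<open>ln \<circ> \<Gamma>\<close> lies above its tangent at \<open>3 / 2\<close>. The minimum of \<open>\<Gamma>\<close> is close to this
  point, so that the slope \<open>2 - \<gamma> - 2 ln 2\<close> is small, and \<open>\<Gamma>(3 / 2) = \<surd>\<pi> / 2\<close>.
\<close>
lemma Gamma_real_ge_four_fifths:
  fixes s :: real
  assumes s: "0 \<le> s" "s \<le> 1"
  shows "4 / 5 \<le> Gamma (1 + s)"
proof -
  let ?D = "Digamma (3 / 2 :: real)"
  have half: "(1 / 2 :: real) \<notin> \<int>\<^sub>\<le>\<^sub>0" by (auto elim!: nonpos_Ints_cases')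
  have D: "?D = 2 - euler_mascheroni - 2 * ln 2"
    using Digamma_plus1[of "1/2 :: real"] Digamma_one_half[where 'a = real] by simp
  have "\<bar>?D\<bar> \<le> 1 / 10"
    unfolding D using euler_mascheroni_less_13_over_22 euler_mascheroni_gt_19_over_33
      ln2_ge_two_thirds ln2_le_25_over_36 by (simp add: abs_le_iff)
  moreover have "\<bar>s - 1 / 2\<bar> \<le> 1 / 2" using s by arith
  ultimately have "\<bar>?D * (s - 1 / 2)\<bar> \<le> 1 / 10 * (1 / 2)"
    unfolding abs_mult by (intro mult_mono) auto
  moreover have "(ln \<circ> Gamma) (1 + s) - (ln \<circ> Gamma) (3 / 2) \<ge> ?D * (1 + s - 3 / 2)"
    using s by (intro convex_on_imp_above_tangent[OF log_convex_Gamma_real])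
      (auto simp: interior_open o_def Gamma_eq_zero_iff
            intro!: derivative_eq_intros Gamma_real_pos elim!: nonpos_Ints_cases')
  moreover have "?D * (1 + s - 3 / 2) = ?D * (s - 1 / 2)" by simp
  ultimately have "ln (Gamma (1 + s)) \<ge> ln (Gamma (3 / 2)) - 1 / 20"
    unfolding o_def abs_le_iff by linarith
  then have "exp (ln (Gamma (3 / 2)) - 1 / 20) \<le> exp (ln (Gamma (1 + s)))"
    by (simp only: exp_le_cancel_iff)
  moreover have "exp (ln (Gamma (3 / 2)) - 1 / 20) = exp (ln (Gamma (3 / 2))) * exp (- (1 / 20 :: real))"
    by (simp only: mult_exp_exp diff_conv_add_uminus)
  ultimately have "Gamma (3 / 2) * exp (- (1 / 20)) \<le> Gamma (1 + s)"
    using s by (simp add: Gamma_real_pos)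
  moreover have "Gamma (3 / 2 :: real) = sqrt pi / 2"
    using Gamma_plus1[OF half] by (simp add: Gamma_one_half_real)
  moreover have "sqrt pi \<ge> 17 / 10"
    using pi_approx by (intro real_le_rsqrt) (auto simp: power2_eq_square)
  then have "(17 / 20) * (19 / 20) \<le> sqrt pi / 2 * exp (- (1 / 20))"
    using exp_ge_add_one_self[of "- (1 / 20)"] by (intro mult_mono) auto
  ultimately show ?thesis by simp
qed

text \<open>
  The loss incurred by using a Gaussian in place of the torsion function of the ball is at most \<open>2\<close>,
  because \<open>e \<ge> 8 / 3\<close>, so that the left-hand side is at most \<open>8 / 5\<close>.
\<close>
lemma inverse_one_minus_exp_le:
  fixes s :: real
  assumes s: "0 \<le> s" "s \<le> 1"
  shows "1 / (1 - exp (- 1)) \<le> 2 * Gamma (1 + s)"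
proof -
  have "(1 + 1/4 + (1/4)\<^sup>2 / 2) ^ 4 \<le> exp (1 / 4 :: real) ^ 4"
    by (intro power_mono exp_lower_Taylor_quadratic) auto
  also have "exp (1 / 4 :: real) ^ 4 = exp 1"
    by (simp flip: exp_of_nat_mult)
  finally have "8 / 3 \<le> exp (1 :: real)" by (simp add: power_divide)
  then have "exp (- 1 :: real) \<le> 3 / 8" by (simp add: exp_minus field_simps)
  then have "1 / (1 - exp (- 1 :: real)) \<le> 8 / 5"
    by (simp add: field_simps)
  then show ?thesis using Gamma_real_ge_four_fifths[OF s] by linarith
qed

lemma frac_const_mult_radial_integral:
  fixes \<beta> s :: real
  assumes k: "k \<ge> 1" and s: "0 < s" "s < 1"
  shows "frac_const k s * (pi powr (k / 2) / Gamma (k / 2) * (Gamma (1 - s) / s * \<beta> powr s))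
           = \<beta> powr s / (2 * eta k s * Gamma (1 + s))"
proof -
  have "- s \<notin> \<int>\<^sub>\<le>\<^sub>0"
    using s by (auto elim!: nonpos_Ints_cases')
  then have "Gamma (1 - s) = - s * Gamma (- s)"
    using Gamma_plus1[of "- s"] by (simp add: add.commute)
  moreover have pos: "Gamma (1 - s) > 0" "Gamma (1 + s) > 0" "Gamma (k / 2) > 0" "Gamma (s + k / 2) > 0"
    using s k by (auto intro!: Gamma_real_pos add_pos_pos)
  ultimately have "Gamma (- s) < 0" and G: "\<bar>Gamma (- s)\<bar> = Gamma (1 - s) / s"
    using s by (auto simp: mult_less_0_iff abs_mult field_simps)
  have "2 powr (2 * s) = 2 * 2 powr (2 * s - 1)" by (simp add: powr_diff)
  then show ?thesis
    using pos[THEN less_imp_neq, THEN not_sym] s unfolding frac_const_def eta_def G add.commute[of s 1]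
    by (simp add: divide_simps)
qed

lemma eta_pos: "k \<ge> 1 \<Longrightarrow> s > 0 \<Longrightarrow> eta k s > 0"
  unfolding eta_def by (auto intro!: divide_pos_pos mult_pos_pos Gamma_real_pos add_pos_pos)

lemma eta_one:
  assumes "k \<ge> 1"
  shows "eta k 1 = 1 / (2 * real k)"
proof -
  define G where "G = Gamma (real k / 2)"
  have pos: "G > 0" using assms unfolding G_def by (intro Gamma_real_pos) auto
  have "real k / 2 \<notin> \<int>\<^sub>\<le>\<^sub>0" using assms by (auto elim!: nonpos_Ints_cases')
  then have "Gamma (1 + real k / 2) = real k / 2 * G"
    using Gamma_plus1[of "real k / 2"] \<open>real k / 2 \<notin> \<int>\<^sub>\<le>\<^sub>0\<close> unfolding G_def
    by (metis add.commute)
  moreover have "Gamma (1 + 1 :: real) = 1" using Gamma_plus1[of "1 :: real"] by simp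
  ultimately show ?thesis using pos assms unfolding eta_def G_def[symmetric] by (simp add: field_simps)
qed

section \<open>Second differences and second derivatives\<close>

text \<open>
  The second derivative at \<open>0\<close> of the even function \<open>k h = g h + g (-h) - c h\<^sup>2\<close> is \<open>2 (D - c)\<close>. If it
  were positive, then \<open>k' > 0\<close> to the right of \<open>0\<close>, and \<open>k\<close> would exceed \<open>k 0\<close> there. The proof
  is confined to a first derivative near \<open>0\<close> and a second one at \<open>0\<close>, which is all that
  \<open>dir_twice_differentiable\<close> provides.
\<close>
lemma second_difference_le_imp_deriv2_le:
  fixes g g' :: "real \<Rightarrow> real"
  assumes g: "\<forall>\<^sub>F h in nhds 0. (g has_field_derivative g' h) (at h)"
    and g': "(g' has_field_derivative D) (at 0)"
    and le: "\<forall>\<^sub>F h in nhds 0. g h + g (- h) - 2 * g 0 \<le> c * h\<^sup>2"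
  shows "D \<le> c"
proof (rule ccontr)
  assume "\<not> D \<le> c"
  define k k' where "k = (\<lambda>h. g h + g (- h) - c * h\<^sup>2)" and "k' = (\<lambda>h. g' h - g' (- h) - 2 * c * h)"
  have "(k' has_field_derivative 2 * D - 2 * c) (at 0)"
    using g' unfolding k'_def
    by (auto intro!: derivative_eq_intros DERIV_chain2[where f = g' and g = uminus])
  from DERIV_pos_inc_right[OF this] \<open>\<not> D \<le> c\<close>
  obtain \<delta> where \<delta>: "\<delta> > 0" "\<And>h. h > 0 \<Longrightarrow> h < \<delta> \<Longrightarrow> k' h > 0"
    by (auto simp: k'_def)
  from g le have "\<forall>\<^sub>F h in nhds (0::real). (g has_field_derivative g' h) (at h) \<and>
      g h + g (- h) - 2 * g 0 \<le> c * h\<^sup>2"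
    by (rule eventually_conj)
  then obtain \<epsilon> where \<epsilon>: "\<epsilon> > 0" "\<And>h. \<bar>h\<bar> < \<epsilon> \<Longrightarrow> (g has_field_derivative g' h) (at h)"
      "\<And>h. \<bar>h\<bar> < \<epsilon> \<Longrightarrow> g h + g (- h) - 2 * g 0 \<le> c * h\<^sup>2"
    by (auto simp: eventually_nhds_metric dist_real_def)
  define r where "r = min \<delta> \<epsilon> / 2"
  have r: "r > 0" "r < \<delta>" "r < \<epsilon>" using \<delta>(1) \<epsilon>(1) by (auto simp: r_def)
  have "k 0 < k r"
  proof (rule DERIV_pos_imp_increasing_open[OF r(1)])
    have k: "(k has_field_derivative k' h) (at h)" if "\<bar>h\<bar> < \<epsilon>" for h
      unfolding k_def k'_def using \<epsilon>(2)[of h] \<epsilon>(2)[of "- h"] that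
      by (auto intro!: derivative_eq_intros DERIV_chain2[where f = g and g = uminus])
    show "\<exists>y. (k has_real_derivative y) (at h) \<and> y > 0" if "0 < h" "h < r" for h
      using k[of h] \<delta>(2)[of h] that r by auto
    show "continuous_on {0..r} k"
      using r by (auto intro!: continuous_at_imp_continuous_on DERIV_isCont[OF k])
  qed
  then show False using \<epsilon>(3)[of r] r by (auto simp: k_def)
qed

lemma dir_twice_differentiableD:
  assumes "dir_twice_differentiable v u p"
  shows "\<forall>\<^sub>F h in nhds 0. ((\<lambda>h. u (p + h *\<^sub>R v)) has_field_derivative dir_deriv v u (p + h *\<^sub>R v)) (at h)"
    and "((\<lambda>h. dir_deriv v u (p + h *\<^sub>R v)) has_field_derivative dir_deriv v (dir_deriv v u) p) (at 0)"
proof -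
  have D: "((\<lambda>h. w (x + h *\<^sub>R v)) has_field_derivative dir_deriv v w x) (at 0)"
    if "dir_differentiable v w x" for w x
    using that unfolding dir_differentiable_def dir_deriv_def
    by (simp add: DERIV_deriv_iff_real_differentiable)
  show "((\<lambda>h. dir_deriv v u (p + h *\<^sub>R v)) has_field_derivative dir_deriv v (dir_deriv v u) p) (at 0)"
    using assms by (intro D) (simp add: dir_twice_differentiable_def)
  have "\<forall>\<^sub>F h in nhds 0. dir_differentiable v u (p + h *\<^sub>R v)"
    using assms by (simp add: dir_twice_differentiable_def)
  then show "\<forall>\<^sub>F h in nhds 0.
      ((\<lambda>h. u (p + h *\<^sub>R v)) has_field_derivative dir_deriv v u (p + h *\<^sub>R v)) (at h)"
  proof eventually_elim
    case (elim h)
    have "((\<lambda>k. u (p + h *\<^sub>R v + (k - h) *\<^sub>R v)) has_field_derivative dir_deriv v u (p + h *\<^sub>R v)) (at h)"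
      by (rule DERIV_chain2[where g = "\<lambda>k. k - h" and Db = 1, THEN DERIV_cong])
         (use D[OF elim] in \<open>auto intro!: derivative_eq_intros\<close>)
    then show ?case by (simp add: algebra_simps)
  qed
qed

text \<open>
  The comparison is made for the difference of \<open>u\<close> at two base points, since in the application the
  second differences of \<open>u - u\<^sup>*\<close> are controlled, and not those of \<open>u\<close>.
\<close>
lemma dir_deriv2_diff_ge:
  assumes p: "dir_twice_differentiable v u p" and q: "dir_twice_differentiable v u q"
    and ge: "\<forall>\<^sub>F h in nhds 0. (2 * u p - u (p + h *\<^sub>R v) - u (p - h *\<^sub>R v))
                 - (2 * u q - u (q + h *\<^sub>R v) - u (q - h *\<^sub>R v)) \<ge> c * h\<^sup>2"
  shows "- dir_deriv v (dir_deriv v u) p - (- dir_deriv v (dir_deriv v u) q) \<ge> c"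
proof -
  note P = dir_twice_differentiableD[OF p] and Q = dir_twice_differentiableD[OF q]
  have "dir_deriv v (dir_deriv v u) p - dir_deriv v (dir_deriv v u) q \<le> - c"
  proof (rule second_difference_le_imp_deriv2_le)
    show "\<forall>\<^sub>F h in nhds 0. ((\<lambda>h. u (p + h *\<^sub>R v) - u (q + h *\<^sub>R v)) has_field_derivative
        dir_deriv v u (p + h *\<^sub>R v) - dir_deriv v u (q + h *\<^sub>R v)) (at h)"
      using P(1) Q(1) by eventually_elim (rule DERIV_diff)
    show "((\<lambda>h. dir_deriv v u (p + h *\<^sub>R v) - dir_deriv v u (q + h *\<^sub>R v)) has_field_derivative
        dir_deriv v (dir_deriv v u) p - dir_deriv v (dir_deriv v u) q) (at 0)"
      using P(2) Q(2) by (rule DERIV_diff)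
    show "\<forall>\<^sub>F h in nhds 0. u (p + h *\<^sub>R v) - u (q + h *\<^sub>R v) + (u (p + (- h) *\<^sub>R v) - u (q + (- h) *\<^sub>R v))
        - 2 * (u (p + 0 *\<^sub>R v) - u (q + 0 *\<^sub>R v)) \<le> - c * h\<^sup>2"
      using ge by eventually_elim simp
  qed
  then show ?thesis by simp
qed

section \<open>Coordinates in groups\<close>

locale grouped_basis =
  fixes n m :: nat and N :: "nat \<Rightarrow> nat" and e :: "nat \<Rightarrow> 'a::euclidean_space"
  assumes basis: "bij_betw e {1..n} Basis"
    and m_pos: "m \<ge> 1"
    and N_sum: "(\<Sum>i\<in>{1..<m}. N i) = n - 1"
    and N_m: "N m = 1"
begin

abbreviation idx :: "nat \<Rightarrow> nat \<Rightarrow> nat" where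
  "idx i j \<equiv> offset N (i - 1) + j"

lemma n_pos: "n \<ge> 1"
  using bij_betw_same_card[OF basis] DIM_positive[where 'a = 'a] by simp

lemma inner_e:
  assumes "k \<in> {1..n}" "l \<in> {1..n}"
  shows "e k \<bullet> e l = (if k = l then 1 else 0)"
  using assms bij_betwE[OF basis] bij_betw_imp_inj_on[OF basis]
  by (auto simp: inner_Basis inj_on_eq_iff)

lemma offset_mono: "i \<le> j \<Longrightarrow> offset N i \<le> offset N j"
  unfolding offset_def by (intro sum_mono2) auto

lemma offset_step: "i \<ge> 1 \<Longrightarrow> offset N i = offset N (i - 1) + N i"
  by (cases i) (auto simp: offset_def)

lemma offset_last: "offset N (m - 1) = n - 1"
proof -
  have "{1..m - 1} = {1..<m}" using m_pos by auto
  then show ?thesis using N_sum by (simp add: offset_def)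
qed

lemma idx_last: "idx m (Suc 0) = n"
  using offset_last n_pos by simp

lemma idx_le_offset: "i \<ge> 1 \<Longrightarrow> j \<le> N i \<Longrightarrow> idx i j \<le> offset N i"
  using offset_step[of i] by simp

lemma idx_in_range:
  assumes "i \<in> {1..m}" "j \<in> {1..N i}"
  shows "idx i j \<in> {1..n}"
proof -
  have "idx i j \<le> offset N m"
    using idx_le_offset[of i j] offset_mono[of i m] assms by auto
  also have "\<dots> = n" using offset_step[of m] m_pos offset_last n_pos N_m by simp
  finally show ?thesis using assms by auto
qed

lemma idx_eq_iff:
  assumes "i \<in> {1..m}" "j \<in> {1..N i}" "k \<in> {1..m}" "l \<in> {1..N k}"
  shows "idx i j = idx k l \<longleftrightarrow> i = k \<and> j = l"
proof -
  have less: "idx i j < idx k l" if "i < k" "i \<ge> 1" "j \<le> N i" "l \<ge> 1" for i j k l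
  proof -
    have "offset N i \<le> offset N (k - 1)" using that by (intro offset_mono) auto
    then show ?thesis using idx_le_offset[of i j] that by linarith
  qed
  show ?thesis
    using less[of i k j l] less[of k i l j] assms by (cases i k rule: linorder_cases) auto
qed

lemma inner_group_embed:
  assumes i: "i \<in> {1..m}" and k: "k \<in> {1..m}" "l \<in> {1..N k}"
  shows "group_embed e N i y \<bullet> e (idx k l) = (if i = k then y l else 0)"
proof -
  have "group_embed e N i y \<bullet> e (idx k l) = (\<Sum>j=1..N i. y j * (if i = k \<and> j = l then 1 else 0))"
    unfolding group_embed_def inner_sum_left inner_scaleR_left
  proof (intro sum.cong refl)
    fix j assume j: "j \<in> {1..N i}"
    show "y j * (e (idx i j) \<bullet> e (idx k l)) = y j * (if i = k \<and> j = l then 1 else 0)"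
      unfolding inner_e[OF idx_in_range[OF i j] idx_in_range[OF k]] idx_eq_iff[OF i j k] ..
  qed
  also have "\<dots> = (if i = k then y l else 0)"
    using k by (auto simp: if_distrib sum.delta cong: if_cong)
  finally show ?thesis .
qed

lemma inner_group_embed_last:
  "i \<in> {1..<m} \<Longrightarrow> group_embed e N i y \<bullet> e n = 0"
  using inner_group_embed[of i m 1 y] N_m idx_last by auto

lemma norm_group_embed:
  assumes i: "i \<in> {1..m}"
  shows "norm (group_embed e N i y) = sqrt (\<Sum>j=1..N i. (y j)\<^sup>2)"
proof -
  let ?Y = "group_embed e N i y"
  have "?Y \<bullet> ?Y = (\<Sum>j=1..N i. y j * (?Y \<bullet> e (idx i j)))"
    by (subst (2) group_embed_def) (simp add: inner_sum_right)
  also have "\<dots> = (\<Sum>j=1..N i. (y j)\<^sup>2)"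
    using i by (intro sum.cong refl) (simp only: inner_group_embed power2_eq_square if_True simp_thms)
  finally show ?thesis by (simp add: norm_eq_sqrt_inner)
qed

lemma group_embed_single:
  "j \<in> {1..N i} \<Longrightarrow> group_embed e N i (\<lambda>l. if l = j then h else 0) = h *\<^sub>R e (idx i j)"
  by (simp add: group_embed_def if_distrib[of "\<lambda>x. x *\<^sub>R _"] sum.delta cong: if_cong)

text \<open>
  This is \<open>\<bar>X\<^sub>i\<bar>\<^sup>2\<close>.
\<close>
definition group_sq :: "nat \<Rightarrow> 'a \<Rightarrow> real" where
  "group_sq i x = (\<Sum>j=1..N i. (x \<bullet> e (idx i j))\<^sup>2)"

lemma group_sq_nonneg: "group_sq i x \<ge> 0"
  by (simp add: group_sq_def sum_nonneg)

lemma continuous_on_group_sq [continuous_intros]: "continuous_on A (group_sq i)"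
  unfolding group_sq_def by (intro continuous_intros)

lemma sum_idx: "(\<Sum>i=1..k. \<Sum>j=1..N i. g (idx i j)) = (\<Sum>l=1..offset N k. g l :: real)"
proof (induction k)
  case (Suc k)
  have "offset N (Suc k) = offset N k + N (Suc k)" by (simp add: offset_def)
  moreover have "(\<Sum>j=1..N (Suc k). g (offset N k + j)) = sum g {offset N k + 1..offset N k + N (Suc k)}"
    using sum.shift_bounds_cl_nat_ivl[of g 1 "offset N k" "N (Suc k)"] by (simp add: add.commute)
  ultimately show ?case
    using Suc sum.ub_add_nat[of 1 "offset N k" g "N (Suc k)"] by simp
qed (simp add: offset_def)

lemma norm_square_eq: "(norm x)\<^sup>2 = (\<Sum>i\<in>{1..<m}. group_sq i x) + (x \<bullet> e n)\<^sup>2"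
proof -
  have "(norm x)\<^sup>2 = (\<Sum>b\<in>Basis. (x \<bullet> b)\<^sup>2)"
    unfolding power2_norm_eq_inner by (subst euclidean_inner) (simp add: power2_eq_square)
  also have "\<dots> = (\<Sum>l=1..n. (x \<bullet> e l)\<^sup>2)"
    by (rule sum.reindex_bij_betw[OF basis, symmetric])
  also have "\<dots> = (\<Sum>l=1..n - 1. (x \<bullet> e l)\<^sup>2) + (x \<bullet> e n)\<^sup>2"
    using n_pos by (cases n) auto
  also have "(\<Sum>l=1..n - 1. (x \<bullet> e l)\<^sup>2) = (\<Sum>i=1..m - 1. group_sq i x)"
    unfolding group_sq_def sum_idx[of "\<lambda>l. (x \<bullet> e l)\<^sup>2" "m - 1"] offset_last ..
  also have "{1..m - 1} = {1..<m}" using m_pos by auto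
  finally show ?thesis .
qed

lemma group_sq_add_same:
  assumes i: "i \<in> {1..m}"
  shows "group_sq i (x + group_embed e N i y)
      = group_sq i x + (\<Sum>j=1..N i. (y j)\<^sup>2) + 2 * (\<Sum>j=1..N i. (x \<bullet> e (idx i j)) * y j)"
    and "group_sq i (x - group_embed e N i y)
      = group_sq i x + (\<Sum>j=1..N i. (y j)\<^sup>2) - 2 * (\<Sum>j=1..N i. (x \<bullet> e (idx i j)) * y j)"
proof -
  have "(x + group_embed e N i y) \<bullet> e (idx i j) = x \<bullet> e (idx i j) + y j"
    "(x - group_embed e N i y) \<bullet> e (idx i j) = x \<bullet> e (idx i j) - y j" if "j \<in> {1..N i}" for j
    unfolding inner_add_left inner_diff_left using inner_group_embed[OF i i that] by auto
  then show "group_sq i (x + group_embed e N i y)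
      = group_sq i x + (\<Sum>j=1..N i. (y j)\<^sup>2) + 2 * (\<Sum>j=1..N i. (x \<bullet> e (idx i j)) * y j)"
    "group_sq i (x - group_embed e N i y)
      = group_sq i x + (\<Sum>j=1..N i. (y j)\<^sup>2) - 2 * (\<Sum>j=1..N i. (x \<bullet> e (idx i j)) * y j)"
    unfolding group_sq_def
    by (simp_all only: power2_sum power2_diff sum.distrib sum_subtractf sum_distrib_left mult.assoc cong: sum.cong)
qed

lemma group_sq_add_other:
  assumes "i \<in> {1..m}" "k \<in> {1..m}" "i \<noteq> k"
  shows "group_sq k (x + group_embed e N i y) = group_sq k x"
    and "group_sq k (x - group_embed e N i y) = group_sq k x"
proof -
  have "group_embed e N i y \<bullet> e (idx k j) = 0" if "j \<in> {1..N k}" for j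
    using inner_group_embed[OF assms(1,2) that] assms(3) by simp
  then show "group_sq k (x + group_embed e N i y) = group_sq k x"
    "group_sq k (x - group_embed e N i y) = group_sq k x"
    unfolding group_sq_def by (simp_all add: inner_add_left inner_diff_left)
qed

text \<open>
  With \<open>b\<close> the inner product term, \<open>\<bar>X\<^sub>i \<plusminus> y\<bar>\<^sup>2 = \<bar>X\<^sub>i\<bar>\<^sup>2 + \<bar>y\<bar>\<^sup>2 \<plusminus> b\<close>, and
  \<open>e\<^sup>b + e\<^bsup>-b\<^esup> \<ge> 2\<close>. Hence the left-hand side is at most
  \<open>2 e\<^bsup>-\<beta> \<bar>X\<^sub>i\<bar>\<^sup>2\<^esup> (1 - e\<^bsup>-\<beta> \<bar>y\<bar>\<^sup>2\<^esup>)\<close>.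
\<close>
lemma gaussian_second_difference_le:
  assumes i: "i \<in> {1..m}" and \<beta>: "\<beta> \<ge> 0"
  shows "2 * exp (- (\<beta> * group_sq i x)) - exp (- (\<beta> * group_sq i (x + group_embed e N i y)))
           - exp (- (\<beta> * group_sq i (x - group_embed e N i y)))
         \<le> 2 * (1 - exp (- (\<beta> * (\<Sum>j=1..N i. (y j)\<^sup>2))))"
proof -
  let ?Y = "\<Sum>j=1..N i. (y j)\<^sup>2" and ?b = "\<beta> * (2 * (\<Sum>j=1..N i. (x \<bullet> e (idx i j)) * y j))"
  let ?G = "exp (- (\<beta> * group_sq i x))" and ?E = "exp (- (\<beta> * ?Y))"
  have "exp (- (\<beta> * group_sq i (x + group_embed e N i y))) = ?G * ?E * exp (- ?b)"
    "exp (- (\<beta> * group_sq i (x - group_embed e N i y))) = ?G * ?E * exp ?b"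
    by (simp_all add: group_sq_add_same[OF i] algebra_simps flip: exp_add)
  moreover have "2 \<le> exp ?b + exp (- ?b)"
    using exp_ge_add_one_self[of ?b] exp_ge_add_one_self[of "- ?b"] by linarith
  then have "?G * ?E * 2 \<le> ?G * ?E * (exp ?b + exp (- ?b))"
    by (intro mult_left_mono) auto
  moreover have "?E \<le> 1" "?G \<le> 1"
    using \<beta> by (auto intro!: mult_nonneg_nonneg sum_nonneg group_sq_nonneg)
  then have "?G * (1 - ?E) \<le> 1 * (1 - ?E)" by (intro mult_right_mono) auto
  ultimately show ?thesis by (simp add: algebra_simps)
qed

definition mirror :: "'a \<Rightarrow> 'a" where
  "mirror x = x - (2 * (x \<bullet> e n)) *\<^sub>R e n"

lemma inner_e_last: "e n \<bullet> e n = 1"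
  using inner_e[of n n] n_pos by simp

lemma inner_e_last_idx:
  assumes "i \<in> {1..<m}" "j \<in> {1..N i}"
  shows "e n \<bullet> e (idx i j) = 0"
proof -
  have "offset N i \<le> n - 1"
    unfolding offset_last[symmetric] using assms by (intro offset_mono) auto
  then have "idx i j \<noteq> n" using idx_le_offset[of i j] n_pos assms by auto
  then show ?thesis using inner_e[of n "idx i j"] idx_in_range[of i j] n_pos assms by auto
qed

lemma group_sq_add_last:
  "i \<in> {1..<m} \<Longrightarrow> group_sq i (x + h *\<^sub>R e n) = group_sq i x"
  unfolding group_sq_def inner_add_left inner_scaleR_left
  by (intro sum.cong refl) (simp only: inner_e_last_idx mult_zero_right add_0_right)

lemma group_sq_diff_last:
  "i \<in> {1..<m} \<Longrightarrow> group_sq i (x - h *\<^sub>R e n) = group_sq i x"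
  using group_sq_add_last[of i x "- h"] by simp

lemma mirror_inner_last: "mirror x \<bullet> e n = - (x \<bullet> e n)"
  by (simp add: mirror_def inner_diff_left inner_e_last)

lemma group_sq_mirror: "i \<in> {1..<m} \<Longrightarrow> group_sq i (mirror x) = group_sq i x"
  unfolding mirror_def by (rule group_sq_diff_last)

lemma mirror_group_embed:
  assumes "i \<in> {1..<m}"
  shows "mirror (x + group_embed e N i y) = mirror x + group_embed e N i y"
    and "mirror (x - group_embed e N i y) = mirror x - group_embed e N i y"
  using assms by (simp_all add: mirror_def inner_add_left inner_diff_left inner_group_embed_last)

lemma mirror_last:
  "mirror (x + h *\<^sub>R e n) = mirror x - h *\<^sub>R e n" "mirror (x - h *\<^sub>R e n) = mirror x + h *\<^sub>R e n"
  by (simp_all add: mirror_def inner_add_left inner_diff_left inner_e_last algebra_simps flip: scaleR_2)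

lemma continuous_on_mirror [continuous_intros]: "continuous_on A mirror"
  unfolding mirror_def by (intro continuous_intros)

lemma mem_cyl_iff:
  assumes "\<forall>i\<in>{1..m}. d i > 0"
  shows "x \<in> cyl n m e N d \<kappa> \<longleftrightarrow> (\<forall>i\<in>{1..<m}. group_sq i x < (d i)\<^sup>2) \<and> \<bar>x \<bullet> e n\<bar> < \<kappa> * d m"
proof -
  have "L2_set (group_coords e N i x) {1..N i} = sqrt (group_sq i x)" for i
    by (simp add: L2_set_def group_coords_def group_sq_def)
  moreover have "sqrt (group_sq i x) < d i \<longleftrightarrow> group_sq i x < (d i)\<^sup>2" if "i \<in> {1..<m}" for i
  proof -
    have "sqrt (group_sq i x) < sqrt ((d i)\<^sup>2) \<longleftrightarrow> group_sq i x < (d i)\<^sup>2" by (rule real_sqrt_less_iff)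
    then show ?thesis using assms that by (simp add: less_imp_le)
  qed
  ultimately show ?thesis
    by (auto simp: cyl_def eball_def group_coords_def abs_less_iff)
qed

section \<open>From second differences to the operators\<close>

text \<open>
  Both cases of the definition lead to the same constant: for \<open>s < 1\<close> it comes from the singular
  integral of \<open>1 - e\<^bsup>-\<beta> \<bar>y\<bar>\<^sup>2\<^esup>\<close>, and for \<open>s = 1\<close> each of the \<open>N i\<close> second derivatives
  contributes \<open>-B \<beta>\<close>, because \<open>1 - e\<^bsup>-\<beta> h\<^sup>2\<^esup> \<le> \<beta> h\<^sup>2\<close>, while
  \<open>eta (N i) 1 = 1 / (2 N i)\<close>.
\<close>
lemma frac_lap_diff_ge:
  assumes i: "i \<in> {1..m}" and N: "N i \<ge> 1" and s: "0 < s" "s \<le> 1" and \<beta>: "\<beta> > 0" and B: "B \<ge> 0"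
    and p: "frac_lap_defined e N i s u p" and q: "frac_lap_defined e N i s u q"
    and ge: "\<And>y. (2 * u p - u (p + group_embed e N i y) - u (p - group_embed e N i y))
        - (2 * u q - u (q + group_embed e N i y) - u (q - group_embed e N i y))
        \<ge> - (B * (1 - exp (- (\<beta> * (\<Sum>j=1..N i. (y j)\<^sup>2)))))"
  shows "frac_lap e N i s u p - frac_lap e N i s u q
           \<ge> - (B * (\<beta> powr s / (2 * eta (N i) s * Gamma (1 + s))))"
proof (cases "s = 1")
  case True
  have "Gamma (1 + 1 :: real) = 1" using Gamma_plus1[of "1 :: real"] by simp
  then have "- (B * (\<beta> powr s / (2 * eta (N i) s * Gamma (1 + s)))) = (\<Sum>j=1..N i. - (B * \<beta>))"
    using True \<beta> N by (simp add: eta_one)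
  also have "\<dots> \<le> (\<Sum>j=1..N i. - dir_deriv (e (idx i j)) (dir_deriv (e (idx i j)) u) p
      - (- dir_deriv (e (idx i j)) (dir_deriv (e (idx i j)) u) q))"
  proof (intro sum_mono dir_deriv2_diff_ge)
    fix j assume j: "j \<in> {1..N i}"
    show "dir_twice_differentiable (e (idx i j)) u p" "dir_twice_differentiable (e (idx i j)) u q"
      using p q j True by (auto simp: frac_lap_defined_def)
    show "\<forall>\<^sub>F h in nhds 0. - (B * \<beta>) * h\<^sup>2 \<le>
        2 * u p - u (p + h *\<^sub>R e (idx i j)) - u (p - h *\<^sub>R e (idx i j)) -
        (2 * u q - u (q + h *\<^sub>R e (idx i j)) - u (q - h *\<^sub>R e (idx i j)))"
    proof (intro always_eventually allI)
      fix h :: real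
      have sq: "(\<Sum>l=1..N i. (if l = j then h else 0)\<^sup>2) = h\<^sup>2"
        using j by (simp add: if_distrib[of "\<lambda>x. x\<^sup>2"] sum.delta cong: if_cong)
      have "1 - exp (- (\<beta> * h\<^sup>2)) \<le> \<beta> * h\<^sup>2"
        using exp_ge_add_one_self[of "- (\<beta> * h\<^sup>2)"] by simp
      then have "B * (1 - exp (- (\<beta> * h\<^sup>2))) \<le> B * (\<beta> * h\<^sup>2)"
        using B by (rule mult_left_mono)
      then show "- (B * \<beta>) * h\<^sup>2 \<le>
          2 * u p - u (p + h *\<^sub>R e (idx i j)) - u (p - h *\<^sub>R e (idx i j)) -
          (2 * u q - u (q + h *\<^sub>R e (idx i j)) - u (q - h *\<^sub>R e (idx i j)))"
        using ge[of "\<lambda>l. if l = j then h else 0"] unfolding group_embed_single[OF j] sq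
        by (simp add: mult.assoc)
    qed
  qed
  also have "\<dots> = frac_lap e N i s u p - frac_lap e N i s u q"
    using True by (simp add: frac_lap_def sum_subtractf sum_negf)
  finally show ?thesis .
next
  case False
  then have s1: "s < 1" using s by simp
  let ?M = "Pi\<^sub>M {1..N i} (\<lambda>_. lborel :: real measure)"
  let ?sq = "\<lambda>y. \<Sum>j=1..N i. (y j)\<^sup>2 :: real"
  let ?I = "frac_integrand e N i s u"
  let ?J = "pi powr (N i / 2) / Gamma (N i / 2) * (Gamma (1 - s) / s * \<beta> powr s)"
  define g where "g y = (1 - exp (- (\<beta> * ?sq y))) / sqrt (?sq y) powr (N i + 2 * s)" for y
  have "g \<in> borel_measurable ?M" unfolding g_def by measurable
  have g_nonneg: "g y \<ge> 0" for y
    unfolding g_def using \<beta> by (auto intro!: divide_nonneg_nonneg mult_nonneg_nonneg sum_nonneg)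
  have J: "?J \<ge> 0" using s s1 N \<beta> by (auto intro!: mult_nonneg_nonneg divide_nonneg_nonneg Gamma_real_nonneg)
  have nn: "(\<integral>\<^sup>+y. ennreal (g y) \<partial>?M) \<le> ennreal ?J"
    using nn_integral_gaussian_second_difference[of "{1..N i}" \<beta> s] N \<beta> s s1 by (simp add: g_def)
  have int_g: "integrable ?M g"
  proof (rule integrableI_nonneg)
    show "g \<in> borel_measurable ?M" by fact
    show "AE y in ?M. 0 \<le> g y" by (simp add: g_nonneg)
    show "(\<integral>\<^sup>+y. ennreal (g y) \<partial>?M) < \<infinity>" using nn by (rule le_less_trans) simp
  qed
  have int_le: "(\<integral>y. g y \<partial>?M) \<le> ?J"
    using J nn by (rule integral_real_bounded)
  have int: "integrable ?M (?I p)" "integrable ?M (?I q)"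
    using p q False by (auto simp: frac_lap_defined_def)
  have c: "frac_const (N i) s \<ge> 0"
    unfolding frac_const_def using s N by (auto intro!: divide_nonneg_nonneg mult_nonneg_nonneg Gamma_real_nonneg)
  have "- (B * (\<beta> powr s / (2 * eta (N i) s * Gamma (1 + s)))) = frac_const (N i) s * (- (B * ?J))"
    unfolding frac_const_mult_radial_integral[OF N s(1) s1, symmetric] by simp
  also have "\<dots> \<le> frac_const (N i) s * (\<integral>y. - (B * g y) \<partial>?M)"
    using mult_left_mono[OF int_le B] by (intro mult_left_mono c) simp
  also have "\<dots> \<le> frac_const (N i) s * (\<integral>y. ?I p y - ?I q y \<partial>?M)"
  proof (intro mult_left_mono c integral_mono)
    show "integrable ?M (\<lambda>y. - (B * g y))" "integrable ?M (\<lambda>y. ?I p y - ?I q y)"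
      using int_g int by auto
    show "- (B * g y) \<le> ?I p y - ?I q y" for y
      using divide_right_mono[OF ge[of y], of "norm (group_embed e N i y) powr (N i + 2 * s)"]
      by (simp add: g_def frac_integrand_def norm_group_embed[OF i] flip: diff_divide_distrib)
  qed
  also have "\<dots> = frac_lap e N i s u p - frac_lap e N i s u q"
    using False int by (simp add: frac_lap_def right_diff_distrib)
  finally show ?thesis .
qed

lemma frac_lap_last:
  "frac_lap e N m 1 u x = - dir_deriv (e n) (dir_deriv (e n) u) x"
  "frac_lap_defined e N m 1 u x \<longleftrightarrow> dir_twice_differentiable (e n) u x"
  using idx_last by (simp_all add: frac_lap_def frac_lap_defined_def N_m)

section \<open>Comparison with the barrier\<close>

text \<open>
  The sign \<open>sg\<close> selects the half-space in which the comparison takes place; \<open>u - u \<circ> mirror\<close> is odd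
  in \<open>x\<^sub>n\<close>, so that an upper bound on both sides is an upper bound for the absolute value.
\<close>
lemma odd_part_le_barrier:
  fixes a s d :: "nat \<Rightarrow> real" and f u :: "'a \<Rightarrow> real" and M S \<mu> sg :: real
  assumes N_pos: "\<forall>i\<in>{1..<m}. N i \<ge> 1"
    and a_nonneg: "\<forall>i\<in>{1..<m}. a i \<ge> 0"
    and a_m: "a m > 0"
    and s_range: "\<forall>i\<in>{1..<m}. s i \<in> {0<..1}"
    and s_m: "s m = 1"
    and d_pos: "\<forall>i\<in>{1..m}. d i > 0"
    and sol: "classical_solution m e N a s f (cyl n m e N d 2) u"
    and M: "M > 0" "\<And>x. \<bar>u x\<bar> \<le> M"
    and S: "S \<ge> 0" "\<And>x \<tau>. x \<in> cyl n m e N d 1 \<Longrightarrow> \<tau> \<in> {0<..<d m} \<Longrightarrow>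
        \<bar>f (x + \<tau> *\<^sub>R e n) - f (x - \<tau> *\<^sub>R e n)\<bar> \<le> S"
    and \<mu>: "\<mu> > 0" "\<And>i. i \<in> {1..m} \<Longrightarrow> \<mu> \<le> eta (N i) (s i) * d i powr (2 * s i)"
    and sg: "sg \<in> {- 1, 1}"
    and z: "0 \<le> sg * (z \<bullet> e n)" "sg * (z \<bullet> e n) \<le> d m"
  defines "K \<equiv> (S + 4 * M * (\<Sum>i=1..m. a i) / \<mu>) / a m"
  shows "u z - u (mirror z) \<le> 2 * M * (sg * (z \<bullet> e n)) / d m
      + K / 2 * (sg * (z \<bullet> e n)) * (d m - sg * (z \<bullet> e n))
      + 2 * M / (1 - exp (- 1)) * (\<Sum>i\<in>{1..<m}. 1 - exp (- (1 / (d i)\<^sup>2 * group_sq i z)))"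
proof -
  define C where "C = 1 / (1 - exp (- 1 :: real))"
  define \<beta> where "\<beta> i = 1 / (d i)\<^sup>2" for i
  define w where "w x = (\<Sum>i\<in>{1..<m}. 1 - exp (- (\<beta> i * group_sq i x)))" for x
  define T where "T x = sg * (x \<bullet> e n)" for x
  define \<phi> where "\<phi> x = 2 * M * T x / d m + K / 2 * T x * (d m - T x) + 2 * M * C * w x" for x
  define P where "P x = u x - u (mirror x) - \<phi> x" for x
  have C: "C > 0" by (simp add: C_def)
  have dm: "d m > 0" using d_pos m_pos by simp
  have \<beta>: "\<beta> i > 0" if "i \<in> {1..<m}" for i
    using d_pos that unfolding \<beta>_def by (metis atLeastAtMost_iff atLeastLessThan_iff less_imp_le zero_less_divide_1_iff zero_less_power)
  have a_all: "a i \<ge> 0" if "i \<in> {1..m}" for i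
    using a_nonneg a_m that by (cases "i = m") auto
  have K: "K \<ge> 0" unfolding K_def using S M \<mu> a_m a_all
    by (intro divide_nonneg_nonneg add_nonneg_nonneg mult_nonneg_nonneg sum_nonneg) auto
  have term_nonneg: "1 - exp (- (\<beta> i * group_sq i x)) \<ge> 0" if "i \<in> {1..<m}" for i x
    using \<beta>[OF that] group_sq_nonneg[of i x] by simp
  have w_nonneg: "w x \<ge> 0" for x
    unfolding w_def using term_nonneg by (intro sum_nonneg)
  have u_cont: "continuous_on UNIV u" using sol by (simp add: classical_solution_def)
  have le2M: "u x - u y \<le> 2 * M" for x y
    using M(2)[of x] M(2)[of y] by linarith

  \<comment> \<open>The barrier dominates the odd part outside the open half-cylinder.\<close>
  have boundary: "P x \<le> 0"
    if x: "0 \<le> T x" "T x \<le> d m"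
      and b: "T x = 0 \<or> T x = d m \<or> (\<exists>i\<in>{1..<m}. group_sq i x \<ge> (d i)\<^sup>2)" for x
  proof -
    have parts: "2 * M * T x / d m \<ge> 0" "K / 2 * T x * (d m - T x) \<ge> 0" "2 * M * C * w x \<ge> 0"
      using x M(1) C K dm w_nonneg[of x] by auto
    from b consider "T x = 0" | "T x = d m" | i where "i \<in> {1..<m}" "group_sq i x \<ge> (d i)\<^sup>2"
      by auto
    then show ?thesis
    proof cases
      case 1
      then have fixed: "mirror x = x" using sg by (auto simp: T_def mirror_def)
      show ?thesis using parts unfolding P_def \<phi>_def fixed by linarith
    next
      case 2
      then have "2 * M * T x / d m = 2 * M" using dm by simp
      then show ?thesis using parts le2M[of x "mirror x"] unfolding P_def \<phi>_def by linarith
    next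
      case (3 i)
      have "d i > 0" using d_pos 3 by auto
      then have "1 \<le> \<beta> i * group_sq i x"
        using 3 unfolding \<beta>_def by (simp add: le_divide_eq)
      then have "1 - exp (- 1) \<le> 1 - exp (- (\<beta> i * group_sq i x))" by simp
      also have "\<dots> \<le> w x"
        unfolding w_def using 3 term_nonneg by (intro member_le_sum) auto
      finally have "C * (1 - exp (- 1)) \<le> C * w x" using C by (intro mult_left_mono) auto
      then have "2 * M * 1 \<le> 2 * M * (C * w x)"
        using M(1) by (intro mult_left_mono) (auto simp: C_def)
      then show ?thesis using parts le2M[of x "mirror x"] unfolding P_def \<phi>_def by simp
    qed
  qed

  define Q where "Q = (\<Inter>i\<in>{1..<m}. {x. group_sq i x \<le> (d i)\<^sup>2}) \<inter> {x. 0 \<le> T x} \<inter> {x. T x \<le> d m}"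
  have T_cont: "continuous_on A T" for A
    unfolding T_def by (intro continuous_intros)
  have "closed Q"
    unfolding Q_def
    by (intro closed_Int closed_INT ballI closed_Collect_le continuous_intros T_cont)
  moreover have "bounded Q"
  proof (rule boundedI)
    fix x assume x: "x \<in> Q"
    then have "\<bar>x \<bullet> e n\<bar> \<le> \<bar>d m\<bar>" using sg by (auto simp: Q_def T_def)
    then have "(x \<bullet> e n)\<^sup>2 \<le> (d m)\<^sup>2" by (simp only: abs_le_square_iff)
    moreover have "(\<Sum>i\<in>{1..<m}. group_sq i x) \<le> (\<Sum>i\<in>{1..<m}. (d i)\<^sup>2)"
      using x by (intro sum_mono) (auto simp: Q_def)
    ultimately have "(norm x)\<^sup>2 \<le> (\<Sum>i\<in>{1..<m}. (d i)\<^sup>2) + (d m)\<^sup>2"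
      unfolding norm_square_eq by linarith
    then show "norm x \<le> sqrt ((\<Sum>i\<in>{1..<m}. (d i)\<^sup>2) + (d m)\<^sup>2)"
      by (rule real_le_rsqrt)
  qed
  ultimately have "compact Q" by (simp add: compact_eq_bounded_closed)
  moreover have "0 \<in> Q" using dm by (auto simp: Q_def T_def group_sq_def)
  moreover have "continuous_on Q P"
    unfolding P_def \<phi>_def w_def using dm
    by (intro continuous_intros T_cont continuous_on_subset[OF u_cont]
          continuous_on_compose2[OF u_cont continuous_on_mirror]) auto
  ultimately obtain p where p: "p \<in> Q" "\<And>x. x \<in> Q \<Longrightarrow> P x \<le> P p"
    using continuous_attains_sup[of Q P] by blast

  have "P p \<le> 0"
  proof (rule ccontr)
    assume "\<not> P p \<le> 0"
    then have Pp: "P p > 0" by simp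
    define q where "q = mirror p"
    \<comment> \<open>The maximum over the compact half-cylinder is one over the whole slab, as the nonlocal
    operators require.\<close>
    have max: "P x \<le> P p" if "0 \<le> T x" "T x \<le> d m" for x
    proof (cases "x \<in> Q")
      case False
      then have "\<exists>i\<in>{1..<m}. group_sq i x \<ge> (d i)\<^sup>2" using that by (force simp: Q_def)
      then have "P x \<le> 0" using boundary[of x] that by blast
      then show ?thesis using Pp by simp
    qed (rule p(2))
    have Tp: "0 < T p" "T p < d m" and gp: "\<And>i. i \<in> {1..<m} \<Longrightarrow> group_sq i p < (d i)\<^sup>2"
      using boundary[of p] Pp p(1) unfolding Q_def by (force simp: not_less[symmetric])+
    have Tp_abs: "\<bar>p \<bullet> e n\<bar> = T p" using Tp sg by (auto simp: T_def)
    have pq: "p \<in> cyl n m e N d 2" "q \<in> cyl n m e N d 2"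
      using gp Tp Tp_abs by (simp_all add: mem_cyl_iff[OF d_pos] q_def mirror_inner_last group_sq_mirror)
    have second: "(2 * u p - u x - u y) - (2 * u q - u (mirror x) - u (mirror y)) \<ge> 2 * \<phi> p - \<phi> x - \<phi> y"
      if "0 \<le> T x" "T x \<le> d m" "0 \<le> T y" "T y \<le> d m" for x y
      using max[OF that(1,2)] max[OF that(3,4)] unfolding P_def q_def by linarith
    have defined: "frac_lap_defined e N i (s i) u x"
      if "i \<in> {1..m}" "a i \<noteq> 0" "x \<in> cyl n m e N d 2" for i x
      using sol that unfolding classical_solution_def by blast

    \<comment> \<open>If \<open>a i = 0\<close>, the operator may be undefined at \<open>p\<close>, but it then does not contribute.\<close>
    have other: "a i * (frac_lap e N i (s i) u p - frac_lap e N i (s i) u q) \<ge> a i * (- (4 * M / \<mu>))"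
      if i: "i \<in> {1..<m}" for i
    proof (cases "a i = 0")
      case False
      have i': "i \<in> {1..m}" using i by simp
      have si: "0 < s i" "s i \<le> 1" and Ni: "N i \<ge> 1" and di: "d i > 0"
        using s_range N_pos d_pos i by auto
      let ?\<Gamma> = "Gamma (1 + s i)" and ?X = "eta (N i) (s i) * d i powr (2 * s i)"
      have "frac_lap e N i (s i) u p - frac_lap e N i (s i) u q
          \<ge> - ((4 * M * C) * (\<beta> i powr s i / (2 * eta (N i) (s i) * ?\<Gamma>)))"
      proof (rule frac_lap_diff_ge[OF i' Ni si \<beta>[OF i]])
        show "0 \<le> 4 * M * C" using M(1) C by simp
        show "frac_lap_defined e N i (s i) u p" "frac_lap_defined e N i (s i) u q"
          using defined i' False pq by auto
        fix y :: "nat \<Rightarrow> real"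
        let ?Y = "group_embed e N i y"
        let ?E = "\<lambda>x. exp (- (\<beta> i * group_sq i x))"
        have TY: "T (p + ?Y) = T p" "T (p - ?Y) = T p"
          using i by (simp_all add: T_def inner_add_left inner_diff_left inner_group_embed_last)
        have w_split: "w x = (1 - ?E x) + (\<Sum>k\<in>{1..<m} - {i}. 1 - exp (- (\<beta> k * group_sq k x)))" for x
          unfolding w_def using i by (intro sum.remove) auto
        have rest: "(\<Sum>k\<in>{1..<m} - {i}. 1 - exp (- (\<beta> k * group_sq k x)))
            = (\<Sum>k\<in>{1..<m} - {i}. 1 - exp (- (\<beta> k * group_sq k p)))" if "x \<in> {p + ?Y, p - ?Y}" for x
          using that i by (intro sum.cong) (auto simp: group_sq_add_other)
        have "2 * w p - w (p + ?Y) - w (p - ?Y) = - (2 * ?E p - ?E (p + ?Y) - ?E (p - ?Y))"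
          using rest[of "p + ?Y"] rest[of "p - ?Y"] by (simp add: w_split)
        also have "\<dots> \<ge> - (2 * (1 - exp (- (\<beta> i * (\<Sum>j=1..N i. (y j)\<^sup>2)))))"
          using gaussian_second_difference_le[OF i', of "\<beta> i" p y] \<beta>[OF i] by simp
        finally have "2 * M * C * (2 * w p - w (p + ?Y) - w (p - ?Y))
            \<ge> 2 * M * C * - (2 * (1 - exp (- (\<beta> i * (\<Sum>j=1..N i. (y j)\<^sup>2)))))"
          using M(1) C by (intro mult_left_mono) auto
        moreover have "2 * \<phi> p - \<phi> (p + ?Y) - \<phi> (p - ?Y) = 2 * M * C * (2 * w p - w (p + ?Y) - w (p - ?Y))"
          unfolding \<phi>_def TY by (simp add: add_divide_distrib diff_divide_distrib algebra_simps)
        moreover have "2 * M * C * - (2 * E) = - (4 * M * C * E)" for E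
          by algebra
        moreover have "2 * \<phi> p - \<phi> (p + ?Y) - \<phi> (p - ?Y)
            \<le> (2 * u p - u (p + ?Y) - u (p - ?Y)) - (2 * u q - u (q + ?Y) - u (q - ?Y))"
          unfolding q_def mirror_group_embed[OF i, symmetric]
          by (rule second[unfolded q_def]) (use Tp in \<open>simp_all add: TY\<close>)
        ultimately show "(2 * u p - u (p + ?Y) - u (p - ?Y)) - (2 * u q - u (q + ?Y) - u (q - ?Y))
            \<ge> - (4 * M * C * (1 - exp (- (\<beta> i * (\<Sum>j=1..N i. (y j)\<^sup>2)))))"
          by linarith
      qed
      moreover have "(4 * M * C) * (\<beta> i powr s i / (2 * eta (N i) (s i) * ?\<Gamma>)) \<le> 4 * M / \<mu>"
      proof -
        have X: "?X \<ge> \<mu>" "?X > 0" using \<mu>(2)[OF i'] \<mu>(1) by auto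
        have \<Gamma>: "C \<le> 2 * ?\<Gamma>" "?\<Gamma> > 0"
          using inverse_one_minus_exp_le[of "s i"] si by (auto simp: C_def)
        have "(d i)\<^sup>2 = d i powr 2" using di by simp
        then have "\<beta> i powr s i = 1 / d i powr (2 * s i)"
          unfolding \<beta>_def by (simp only: powr_divide powr_powr powr_one_eq_one zero_le_one powr_ge_zero)
        then have "(4 * M * C) * (\<beta> i powr s i / (2 * eta (N i) (s i) * ?\<Gamma>)) = 4 * M / ?X * (C / (2 * ?\<Gamma>))"
          by simp
        also have "\<dots> \<le> 4 * M / \<mu> * 1"
          using X \<Gamma> C M(1) \<mu>(1) by (intro mult_mono divide_left_mono) auto
        finally show ?thesis by simp
      qed
      ultimately show ?thesis using a_all[OF i'] by (intro mult_left_mono) auto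
    qed simp

    have last: "frac_lap e N m (s m) u p - frac_lap e N m (s m) u q \<ge> K"
      unfolding s_m frac_lap_last
    proof (rule dir_deriv2_diff_ge)
      show "dir_twice_differentiable (e n) u p" "dir_twice_differentiable (e n) u q"
        using defined[of m] pq a_m m_pos by (auto simp: s_m frac_lap_last)
      have "\<forall>\<^sub>F h in nhds 0. \<bar>h\<bar> < min (T p) (d m - T p)"
        unfolding eventually_nhds_metric using Tp
        by (intro exI[of _ "min (T p) (d m - T p)"]) (simp add: dist_real_def)
      then show "\<forall>\<^sub>F h in nhds 0. K * h\<^sup>2 \<le> 2 * u p - u (p + h *\<^sub>R e n) - u (p - h *\<^sub>R e n) -
          (2 * u q - u (q + h *\<^sub>R e n) - u (q - h *\<^sub>R e n))"
      proof eventually_elim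
        case (elim h)
        let ?x = "p + h *\<^sub>R e n" and ?y = "p - h *\<^sub>R e n"
        have T: "T ?x = T p + sg * h" "T ?y = T p - sg * h"
          by (simp_all add: T_def inner_add_left inner_diff_left inner_e_last algebra_simps)
        have w: "w ?x = w p" "w ?y = w p"
          unfolding w_def by (simp_all add: group_sq_add_last group_sq_diff_last)
        have "2 * \<phi> p - \<phi> ?x - \<phi> ?y = K * (sg * h)\<^sup>2"
          unfolding \<phi>_def T w
          by (simp add: add_divide_distrib diff_divide_distrib algebra_simps power2_eq_square)
        also have "\<dots> = K * h\<^sup>2" using sg by auto
        finally have "2 * \<phi> p - \<phi> ?x - \<phi> ?y = K * h\<^sup>2" .
        moreover have "0 \<le> T ?x" "T ?x \<le> d m" "0 \<le> T ?y" "T ?y \<le> d m"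
          unfolding T using elim sg by auto
        ultimately show ?case
          using second[of ?x ?y] by (simp add: mirror_last q_def)
      qed
    qed

    have "f p - f q = (\<Sum>i=1..m. a i * (frac_lap e N i (s i) u p - frac_lap e N i (s i) u q))"
      using sol pq by (simp add: classical_solution_def aniso_op_def right_diff_distrib sum_subtractf)
    also have "{1..m} = insert m {1..<m}" using m_pos by auto
    also have "(\<Sum>i\<in>insert m {1..<m}. a i * (frac_lap e N i (s i) u p - frac_lap e N i (s i) u q))
        = a m * (frac_lap e N m (s m) u p - frac_lap e N m (s m) u q)
          + (\<Sum>i\<in>{1..<m}. a i * (frac_lap e N i (s i) u p - frac_lap e N i (s i) u q))"
      by simp
    also have "\<dots> \<ge> a m * K + (\<Sum>i\<in>{1..<m}. a i * (- (4 * M / \<mu>)))"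
      by (intro add_mono[OF mult_left_mono[OF last less_imp_le[OF a_m]]] sum_mono other)
    finally have "f p - f q \<ge> a m * K - (\<Sum>i\<in>{1..<m}. a i) * (4 * M / \<mu>)"
      by (simp add: sum_negf sum_distrib_right sum_divide_distrib)
    moreover have "a m * K = S + (\<Sum>i\<in>{1..<m}. a i) * (4 * M / \<mu>) + a m * (4 * M / \<mu>)"
    proof -
      have "(\<Sum>i=1..m. a i) = (\<Sum>i\<in>{1..<m}. a i) + a m"
        unfolding \<open>{1..m} = insert m {1..<m}\<close> by simp
      moreover have "a m * K = S + 4 * M * (\<Sum>i=1..m. a i) / \<mu>" using a_m by (simp add: K_def)
      ultimately show ?thesis by (simp add: add_divide_distrib algebra_simps)
    qed
    moreover have "a m * (4 * M / \<mu>) > 0" using a_m M(1) \<mu>(1) by simp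
    ultimately have "S < \<bar>f p - f q\<bar>" by linarith

    \<comment> \<open>The points \<open>p\<close> and \<open>q\<close> are \<open>x \<plusminus> \<tau> e\<^sub>n\<close> with \<open>x\<close> in the hyperplane \<open>x\<^sub>n = 0\<close>.\<close>
    define x where "x = p - (p \<bullet> e n) *\<^sub>R e n"
    have "x \<in> cyl n m e N d 1"
      using gp dm by (simp add: mem_cyl_iff[OF d_pos] x_def group_sq_diff_last inner_diff_left inner_e_last)
    then have "\<bar>f (x + T p *\<^sub>R e n) - f (x - T p *\<^sub>R e n)\<bar> \<le> S"
      using Tp by (intro S(2)) auto
    moreover have "x + (p \<bullet> e n) *\<^sub>R e n = p" "x - (p \<bullet> e n) *\<^sub>R e n = q"
      unfolding x_def q_def mirror_def mult_2 scaleR_add_left by simp_all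
    then have "\<bar>f (x + T p *\<^sub>R e n) - f (x - T p *\<^sub>R e n)\<bar> = \<bar>f p - f q\<bar>"
      using sg by (auto simp: T_def)
    ultimately show False using \<open>S < \<bar>f p - f q\<bar>\<close> by simp
  qed
  have "P z \<le> 0"
  proof (cases "z \<in> Q")
    case True
    then show ?thesis using p(2) \<open>P p \<le> 0\<close> by force
  next
    case False
    then have "\<exists>i\<in>{1..<m}. group_sq i z \<ge> (d i)\<^sup>2" using z by (force simp: Q_def T_def)
    then show ?thesis using boundary[of z] z unfolding T_def by blast
  qed
  then show ?thesis
    by (simp add: P_def \<phi>_def w_def T_def C_def \<beta>_def)
qed

end

section \<open>The estimate\<close>

text \<open>
  A nonempty open set is not negligible, so an essential bound of a continuous function holds everywhere.
\<close>
lemma abs_le_Linf_norm: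
  fixes u :: "'a::euclidean_space \<Rightarrow> real"
  assumes u: "continuous_on UNIV u"
  shows "ennreal \<bar>u x\<bar> \<le> Linf_norm u"
proof (rule ccontr)
  let ?U = "{x. Linf_norm u < ennreal \<bar>u x\<bar>}"
  assume "\<not> ennreal \<bar>u x\<bar> \<le> Linf_norm u"
  then have "x \<in> ?U" by simp
  have "continuous_on UNIV (\<lambda>x. ennreal \<bar>u x\<bar>)"
    using u by (intro continuous_on_ennreal continuous_intros)
  then have "open ?U" by (intro open_Collect_less continuous_on_const)
  moreover have "emeasure lborel ?U = 0"
    using esssup_zero_measure[of lborel "\<lambda>x. ennreal \<bar>u x\<bar>"] by (simp add: Linf_norm_def)
  ultimately have "?U \<in> null_sets lborel" by (intro null_setsI) auto
  then have "negligible ?U"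
    unfolding negligible_iff_null_sets by (rule null_sets_completionI)
  then show False
    using \<open>open ?U\<close> \<open>x \<in> ?U\<close> open_not_negligible by blast
qed

theorem theorem1p1:
  fixes n m :: nat
    and N :: "nat \<Rightarrow> nat"
    and e :: "nat \<Rightarrow> real ^ 'n"
    and a s d :: "nat \<Rightarrow> real"
    and f u :: "real ^ 'n \<Rightarrow> real"
    and t :: real
  assumes n: "n = CARD('n)"
    and basis: "bij_betw e {1..n} Basis"
    and m: "m \<ge> 1"
    and N_pos: "\<forall>i\<in>{1..<m}. N i \<ge> 1"
    and N_sum: "(\<Sum>i\<in>{1..<m}. N i) = n - 1"
    and N_m: "N m = 1"
    and a_nonneg: "\<forall>i\<in>{1..<m}. a i \<ge> 0"
    and a_m: "a m > 0"
    and s_range: "\<forall>i\<in>{1..<m}. s i \<in> {0<..1}"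
    and s_m: "s m = 1"
    and d_pos: "\<forall>i\<in>{1..m}. d i > 0"
    and sol: "classical_solution m e N a s f (cyl n m e N d 2) u"
    and t: "t \<in> {- d m<..<d m}" "t \<noteq> 0"
  shows "ennreal (\<bar>u (t *\<^sub>R e n) - u (- t *\<^sub>R e n)\<bar> / \<bar>t\<bar>)
    \<le> ennreal (d m)
          * (SUP (x, \<tau>) \<in> cyl n m e N d 1 \<times> {0<..<d m}.
               ennreal \<bar>f (x + \<tau> *\<^sub>R e n) - f (x - \<tau> *\<^sub>R e n)\<bar>)
          / ennreal (a m)
      + ennreal (2 * (\<Sum>i=1..m. a i) / a m + 1) * ennreal (d m) * Linf_norm u
          / ennreal (MIN i\<in>{1..m}. eta (N i) (s i) * d i powr (2 * s i))"
proof -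
  interpret grouped_basis n m N e
    by unfold_locales (use basis m N_sum N_m in auto)
  define \<mu> where "\<mu> = (MIN i\<in>{1..m}. eta (N i) (s i) * d i powr (2 * s i))"
  define \<SS> where "\<SS> = (SUP (x, \<tau>) \<in> cyl n m e N d 1 \<times> {0<..<d m}.
               ennreal \<bar>f (x + \<tau> *\<^sub>R e n) - f (x - \<tau> *\<^sub>R e n)\<bar>)"
  define A where "A = (\<Sum>i=1..m. a i)"
  have dm: "d m > 0" using d_pos m by simp
  have A: "A \<ge> 0"
    unfolding A_def using a_nonneg a_m by (intro sum_nonneg) (metis atLeastAtMost_iff atLeastLessThan_iff le_neq_implies_less less_imp_le)
  have Ca: "2 * A / a m + 1 > 0" using A a_m by (simp add: add_nonneg_pos)
  have pos: "eta (N i) (s i) * d i powr (2 * s i) > 0" if "i \<in> {1..m}" for i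
  proof -
    have "N i \<ge> 1" "s i > 0" "d i > 0"
      using that N_pos N_m s_range s_m d_pos by (cases "i = m"; force)+
    then show ?thesis by (simp add: eta_pos)
  qed
  have \<mu>_pos: "\<mu> > 0" unfolding \<mu>_def using pos m by (subst Min_gr_iff) auto
  have \<mu>_le: "\<mu> \<le> eta (N i) (s i) * d i powr (2 * s i)" if "i \<in> {1..m}" for i
    unfolding \<mu>_def using that by (intro Min_le) auto
  have "\<mu> \<le> (d m)\<^sup>2 / 2"
    using \<mu>_le[of m] m dm by (simp add: N_m s_m eta_one)
  have u_le: "ennreal \<bar>u x\<bar> \<le> Linf_norm u" for x
    using sol by (intro abs_le_Linf_norm) (simp add: classical_solution_def)

  have "ennreal (\<bar>u (t *\<^sub>R e n) - u (- t *\<^sub>R e n)\<bar> / \<bar>t\<bar>)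
    \<le> ennreal (d m) * \<SS> / ennreal (a m)
      + ennreal (2 * A / a m + 1) * ennreal (d m) * Linf_norm u / ennreal \<mu>"
  proof (cases "\<SS> = top \<or> Linf_norm u = top")
    case True
    then have "ennreal (d m) * \<SS> / ennreal (a m)
      + ennreal (2 * A / a m + 1) * ennreal (d m) * Linf_norm u / ennreal \<mu> = top"
      using dm Ca by (auto simp: ennreal_mult_top ennreal_mult'[symmetric] ennreal_top_divide)
    then show ?thesis by (simp only: top_greatest)
  next
    case False
    obtain S M where S: "\<SS> = ennreal S" "S \<ge> 0" and M: "Linf_norm u = ennreal M" "M \<ge> 0"
      using False by (cases \<SS>; cases "Linf_norm u") auto
    have uM: "\<bar>u x\<bar> \<le> M" for x
      using u_le[of x] M by simp
    have fS: "\<bar>f (x + \<tau> *\<^sub>R e n) - f (x - \<tau> *\<^sub>R e n)\<bar> \<le> S"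
      if "x \<in> cyl n m e N d 1" "\<tau> \<in> {0<..<d m}" for x \<tau>
    proof -
      have "ennreal \<bar>f (x + \<tau> *\<^sub>R e n) - f (x - \<tau> *\<^sub>R e n)\<bar> \<le> \<SS>"
        unfolding \<SS>_def by (rule SUP_upper2[of "(x, \<tau>)"]) (use that in auto)
      then show ?thesis using S by simp
    qed
    define R where "R = d m * S / a m + (2 * A / a m + 1) * d m * M / \<mu>"
    have R: "R \<ge> 0" unfolding R_def using dm a_m S M \<mu>_pos Ca by auto
    \<comment> \<open>The barrier is a strict supersolution only for \<open>M > 0\<close>; if \<open>M = 0\<close>, then \<open>u\<close> vanishes.\<close>
    have one_sided: "u (r *\<^sub>R e n) - u (- r *\<^sub>R e n) \<le> \<bar>r\<bar> * R" if r: "\<bar>r\<bar> < d m" "r \<noteq> 0" for r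
    proof (cases "M = 0")
      case True
      then show ?thesis using uM R by simp
    next
      case False
      define K where "K = (S + 4 * M * A / \<mu>) / a m"
      have K: "K \<ge> 0" unfolding K_def using S M A a_m \<mu>_pos by simp
      have sgn: "sgn r * (r *\<^sub>R e n \<bullet> e n) = \<bar>r\<bar>"
        by (simp add: inner_e_last abs_sgn mult.commute)
      have sq: "group_sq i (r *\<^sub>R e n) = 0" if "i \<in> {1..<m}" for i
        using group_sq_add_last[OF that, of 0 r] by (simp add: group_sq_def)
      have "u (r *\<^sub>R e n) - u (- r *\<^sub>R e n) = u (r *\<^sub>R e n) - u (mirror (r *\<^sub>R e n))"
        using mirror_last(1)[of 0 r] by (simp add: mirror_def[of 0])
      also have "\<dots> \<le> 2 * M * \<bar>r\<bar> / d m + K / 2 * \<bar>r\<bar> * (d m - \<bar>r\<bar>)"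
        using odd_part_le_barrier[OF N_pos a_nonneg a_m s_range s_m d_pos sol _ uM S(2) fS \<mu>_pos \<mu>_le,
            of "sgn r" "r *\<^sub>R e n"] False M(2) r
        unfolding sgn A_def K_def by (simp add: sgn_if sq)
      also have "\<dots> \<le> 2 * M * \<bar>r\<bar> / d m + K / 2 * \<bar>r\<bar> * d m"
        using K by (intro add_left_mono mult_left_mono) auto
      also have "\<dots> = \<bar>r\<bar> * (2 * M / d m + K / 2 * d m)" by (simp add: algebra_simps)
      also have "\<dots> \<le> \<bar>r\<bar> * R"
      proof (intro mult_left_mono)
        \<comment> \<open>The summand \<open>1\<close> of \<open>2 A / a m + 1\<close> pays for \<open>2 M / d m\<close>, because \<open>\<eta>\<^sub>m d\<^sub>m\<^sup>2 = d\<^sub>m\<^sup>2 / 2\<close>.\<close>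
        have "2 * \<mu> \<le> d m * d m" using \<open>\<mu> \<le> (d m)\<^sup>2 / 2\<close> by (simp add: power2_eq_square)
        then have "2 * M * \<mu> \<le> d m * M * d m"
          using mult_left_mono[of "2 * \<mu>" "d m * d m" M] M(2) by (simp add: ac_simps)
        then have "2 * M / d m \<le> d m * M / \<mu>" using dm \<mu>_pos by (simp add: field_simps)
        define X Y where "X = d m * S / a m" and "Y = 2 * A / a m * d m * M / \<mu>"
        have "K / 2 * d m = X / 2 + Y"
          unfolding K_def X_def Y_def by (simp add: add_divide_distrib algebra_simps)
        moreover have "X \<ge> 0" unfolding X_def using dm S a_m by simp
        moreover have "R = X + Y + d m * M / \<mu>"
          by (simp add: R_def X_def Y_def add_divide_distrib distrib_right)
        moreover note \<open>2 * M / d m \<le> d m * M / \<mu>\<close>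
        ultimately show "2 * M / d m + K / 2 * d m \<le> R" by linarith
      qed simp
      finally show ?thesis .
    qed
    have "\<bar>u (t *\<^sub>R e n) - u (- t *\<^sub>R e n)\<bar> \<le> \<bar>t\<bar> * R"
      using one_sided[of t] one_sided[of "- t"] t by (auto simp: abs_le_iff)
    then have "\<bar>u (t *\<^sub>R e n) - u (- t *\<^sub>R e n)\<bar> / \<bar>t\<bar> \<le> R"
      using t by (simp add: divide_le_eq mult.commute)
    then have "ennreal (\<bar>u (t *\<^sub>R e n) - u (- t *\<^sub>R e n)\<bar> / \<bar>t\<bar>) \<le> ennreal R"
      by (rule ennreal_leI)
    also have "ennreal R = ennreal (d m) * \<SS> / ennreal (a m)
      + ennreal (2 * A / a m + 1) * ennreal (d m) * Linf_norm u / ennreal \<mu>"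
      unfolding R_def S(1) M(1) using dm a_m S(2) M(2) \<mu>_pos Ca
      by (simp add: ennreal_mult'[symmetric] divide_ennreal ennreal_plus[symmetric] del: ennreal_plus)
    finally show ?thesis .
  qed
  then show ?thesis unfolding \<mu>_def \<SS>_def A_def .
qed

end
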